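(* Let $\mathcal{G}=(\mathcal{V},\mathcal{E},\mathcal{A})$ be a strongly connected directed graph on $N$ nodes with adjacency matrix $\mathcal{A}=[a_{ij}]$. Consider $N$ agents with states $x_i\in\mathbb{R}$ and dynamics $$\dot{x}_i=b_iu_i+\theta_i^T\phi_i(x_i),\qquad i=1,\dots,N,$$ where $u_i\in\mathbb{R}$ is the control input, the $b_i\in\mathbb{R}$ are (unknown) nonzero constants whose signs are arbitrary and possibly different, $\theta_i\in\mathbb{R}^{\ell_i}$ is an (unknown) constant vector, and $\phi_i:\mathbb{R}\to\mathbb{R}^{\ell_i}$ is a (known) smooth function. Let $\rho>0$, $\nu>0$, $\gamma_i>0$ and $\bar{x}_i\in\mathbb{R}$ ($i=1,\dots,N$) be arbitrary constants, let $N(k)=k^2\cos(k)$, and define $$z_i(t):=x_i(t)-\bar{x}_i+\rho\int_0^t\sum_{j\in\mathcal{N}_i}a_{ij}\bigl(x_i(s)-x_j(s)\bigr)\,ds .$$ Let the control inputs be $$u_i=N(\zeta_i)\Bigl[\hat{\theta}_i^T\phi_i(x_i)+\rho\sum_{j\in\mathcal{N}_i}a_{ij}(x_i-x_j)+\nu z_i\Bigr],$$ where $\hat{\theta}_i\in\mathbb{R}^{\ell_i}$ and $\zeta_i\in\mathbb{R}$ are generated by $$\dot{\hat{\theta}}_i=\gamma_i\phi_i(x_i)z_i,\qquad \dot{\zeta}_i=\nu z_i^2+z_i\Bigl[\hat{\theta}_i^T\phi_i(x_i)+\rho\sum_{j\in\mathcal{N}_i}a_{ij}(x_i-x_j)\Bigr].$$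 Then, for arbitrary initial conditions $x_i(0),\hat{\theta}_i(0),\zeta_i(0)$, all signals in the closed loop ($x_i$, $z_i$, the integral term in $z_i$, $\hat{\theta}_i$, $\zeta_i$, $u_i$) are bounded on $[0,\infty)$, and for all $i,j\in\{1,\dots,N\}$ $$\lim_{t\to\infty}\bigl(x_i(t)-x_j(t)\bigr)=0\quad\text{with}\quad \lim_{t\to\infty}x_i(t)=\sum_{k=1}^N\omega_k\bar{x}_k,$$ where $\omega=[\omega_1,\dots,\omega_N]^T$ is the left eigenvector of the Laplacian $L$ of $\mathcal{G}$ associated with the zero eigenvalue, normalized so that $\sum_{k=1}^N\omega_k=1$.
   Context: A directed graph $\mathcal{G}=(\mathcal{V},\mathcal{E},\mathcal{A})$ has node set $\mathcal{V}=\{1,\dots,N\}$, edge set $\mathcal{E}\subseteq\mathcal{V}\times\mathcal{V}$, and adjacency matrix $\mathcal{A}=[a_{ij}]\in\mathbb{R}^{N\times N}$ with $a_{ij}>0$ if $(j,i)\in\mathcal{E}$ and $a_{ij}=0$ otherwise. The neighbor set of agent $i$ is $\mathcal{N}_i=\{j\in\mathcal{V}:(j,i)\in\mathcal{E}\}$. The in-degree of $i$ is $d_i=\sum_{j=1}^N a_{ij}$, and the Laplacian is $L=\mathrm{diag}\{d_1,\dots,d_N\}-\mathcal{A}$. The graph is strongly connected if there is a directed path between any two distinct nodes (in each direction). For a strongly connected graph, $0$ is a simple eigenvalue of $L$ with right eigenvector $[1,\dots,1]^T$ and with a unique left eigenvector $\omega$ ($\omega^TL=0$) satisfying $\sum_{i=1}^N\omega_i=1$;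 its entries $\omega_i$ are positive real numbers. The symbol $N$ denotes the number of agents, while $N(\cdot)$ with an argument denotes the function $N(k)=k^2\cos(k)$, which is an even smooth Nussbaum-type function, i.e. $\limsup_{k\to\infty}\frac1k\int_0^kN(\tau)d\tau=+\infty$ and $\liminf_{k\to\infty}\frac1k\int_0^kN(\tau)d\tau=-\infty$. The closed loop is the autonomous system of ordinary differential equations in the variables $x_i,w_i,\hat{\theta}_i,\zeta_i$ ($i=1,\dots,N$), where $w_i(t)=\int_0^t\sum_{j\in\mathcal{N}_i}a_{ij}(x_i(s)-x_j(s))ds$ (so $w_i(0)=0$) and $z_i=x_i-\bar{x}_i+\rho w_i$. "Unknown" constants are those not used in the controller. *)

theory Defs
  imports "HOL-Analysis.Analysis"
begin

section \<open>Weighted directed graphs\<close>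

text \<open>The nodes are the elements of the finite type \<open>'n\<close>, so \<open>N\<close> is \<open>CARD('n)\<close>. An edge
  \<open>(j, i)\<close> means that agent \<open>i\<close> receives information from agent \<open>j\<close>; accordingly the weight
  of \<open>(j, i)\<close> sits in row \<open>i\<close> and column \<open>j\<close> of the adjacency matrix.\<close>

definition adjacency_matrix :: "('n \<times> 'n) set \<Rightarrow> real^'n^'n \<Rightarrow> bool" where
  "adjacency_matrix E A \<longleftrightarrow>
     (\<forall>i j. ((j, i) \<in> E \<longrightarrow> A $ i $ j > 0) \<and> ((j, i) \<notin> E \<longrightarrow> A $ i $ j = 0))"

definition neighbours :: "('n \<times> 'n) set \<Rightarrow> 'n \<Rightarrow> 'n set" where
  "neighbours E i = {j. (j, i) \<in> E}"

definition strongly_connected :: "('n \<times> 'n) set \<Rightarrow> bool" where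
  "strongly_connected E \<longleftrightarrow> (\<forall>i j. i \<noteq> j \<longrightarrow> (i, j) \<in> E\<^sup>+)"

definition in_degree :: "real^'n^'n \<Rightarrow> 'n \<Rightarrow> real" where
  "in_degree A i = (\<Sum>j\<in>UNIV. A $ i $ j)"

definition laplacian :: "real^'n^'n \<Rightarrow> real^'n^'n" where
  "laplacian A = (\<chi> i j. if i = j then in_degree A i else 0) - A"

section \<open>Agents and control law\<close>

text \<open>The dimension \<open>\<ell>\<^sub>i\<close> of the parameter space depends on the agent, so a vector of dimension
  \<open>l\<close> is a function on \<open>nat\<close> of which only the entries with index below \<open>l\<close> are used.
  A signal of agent \<open>i\<close> at time \<open>t\<close> is written \<open>x i t\<close>.\<close>

definition dotp :: "nat \<Rightarrow> (nat \<Rightarrow> real) \<Rightarrow> (nat \<Rightarrow> real) \<Rightarrow> real" where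
  "dotp l v w = (\<Sum>k<l. v k * w k)"

definition smooth :: "(real \<Rightarrow> real) \<Rightarrow> bool" where
  "smooth f \<longleftrightarrow> (\<forall>n y. (deriv ^^ n) f field_differentiable (at y))"

definition nussbaum :: "real \<Rightarrow> real" where
  "nussbaum k = k\<^sup>2 * cos k"

definition consensus_error ::
  "('n \<times> 'n) set \<Rightarrow> real^'n^'n \<Rightarrow> ('n \<Rightarrow> real \<Rightarrow> real) \<Rightarrow> 'n \<Rightarrow> real \<Rightarrow> real" where
  "consensus_error E A x i t = (\<Sum>j\<in>neighbours E i. A $ i $ j * (x i t - x j t))"

definition consensus_integral ::
  "('n \<times> 'n) set \<Rightarrow> real^'n^'n \<Rightarrow> ('n \<Rightarrow> real \<Rightarrow> real) \<Rightarrow> 'n \<Rightarrow> real \<Rightarrow> real" where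
  "consensus_integral E A x i t = integral {0..t} (\<lambda>s. consensus_error E A x i s)"

definition z_signal ::
  "('n \<times> 'n) set \<Rightarrow> real^'n^'n \<Rightarrow> real \<Rightarrow> ('n \<Rightarrow> real) \<Rightarrow> ('n \<Rightarrow> real \<Rightarrow> real) \<Rightarrow>
   'n \<Rightarrow> real \<Rightarrow> real" where
  "z_signal E A \<rho> xbar x i t = x i t - xbar i + \<rho> * consensus_integral E A x i t"

definition control ::
  "('n \<times> 'n) set \<Rightarrow> real^'n^'n \<Rightarrow> ('n \<Rightarrow> nat) \<Rightarrow> ('n \<Rightarrow> real \<Rightarrow> nat \<Rightarrow> real) \<Rightarrow>
   real \<Rightarrow> real \<Rightarrow> ('n \<Rightarrow> real) \<Rightarrow>
   ('n \<Rightarrow> real \<Rightarrow> real) \<Rightarrow> ('n \<Rightarrow> real \<Rightarrow> nat \<Rightarrow> real) \<Rightarrow> ('n \<Rightarrow> real \<Rightarrow> real) \<Rightarrow>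
   'n \<Rightarrow> real \<Rightarrow> real" where
  "control E A l \<phi> \<rho> \<nu> xbar x \<theta>hat \<zeta> i t =
     nussbaum (\<zeta> i t) *
       (dotp (l i) (\<theta>hat i t) (\<phi> i (x i t)) + \<rho> * consensus_error E A x i t
        + \<nu> * z_signal E A \<rho> xbar x i t)"

text \<open>The within-filter makes the derivative at time \<open>0\<close> one-sided.\<close>

definition closed_loop ::
  "('n \<times> 'n) set \<Rightarrow> real^'n^'n \<Rightarrow> ('n \<Rightarrow> real) \<Rightarrow> ('n \<Rightarrow> nat) \<Rightarrow> ('n \<Rightarrow> nat \<Rightarrow> real) \<Rightarrow>
   ('n \<Rightarrow> real \<Rightarrow> nat \<Rightarrow> real) \<Rightarrow> real \<Rightarrow> real \<Rightarrow> ('n \<Rightarrow> real) \<Rightarrow> ('n \<Rightarrow> real) \<Rightarrow>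
   ('n \<Rightarrow> real \<Rightarrow> real) \<Rightarrow> ('n \<Rightarrow> real \<Rightarrow> nat \<Rightarrow> real) \<Rightarrow> ('n \<Rightarrow> real \<Rightarrow> real) \<Rightarrow> bool" where
  "closed_loop E A b l \<theta> \<phi> \<rho> \<nu> \<gamma> xbar x \<theta>hat \<zeta> \<longleftrightarrow>
     (\<forall>i. \<forall>t\<ge>0.
        (x i has_real_derivative
           b i * control E A l \<phi> \<rho> \<nu> xbar x \<theta>hat \<zeta> i t + dotp (l i) (\<theta> i) (\<phi> i (x i t)))
          (at t within {0..}) \<and>
        (\<forall>k<l i. ((\<lambda>s. \<theta>hat i s k) has_real_derivative
           \<gamma> i * \<phi> i (x i t) k * z_signal E A \<rho> xbar x i t) (at t within {0..})) \<and>
        (\<zeta> i has_real_derivative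
           \<nu> * (z_signal E A \<rho> xbar x i t)\<^sup>2 + z_signal E A \<rho> xbar x i t *
             (dotp (l i) (\<theta>hat i t) (\<phi> i (x i t)) + \<rho> * consensus_error E A x i t))
          (at t within {0..}))"

definition initial_condition ::
  "('n \<Rightarrow> nat) \<Rightarrow> ('n \<Rightarrow> real) \<Rightarrow> ('n \<Rightarrow> nat \<Rightarrow> real) \<Rightarrow> ('n \<Rightarrow> real) \<Rightarrow>
   ('n \<Rightarrow> real \<Rightarrow> real) \<Rightarrow> ('n \<Rightarrow> real \<Rightarrow> nat \<Rightarrow> real) \<Rightarrow> ('n \<Rightarrow> real \<Rightarrow> real) \<Rightarrow> bool" where
  "initial_condition l x0 \<theta>hat0 \<zeta>0 x \<theta>hat \<zeta> \<longleftrightarrow>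
     (\<forall>i. x i 0 = x0 i \<and> (\<forall>k<l i. \<theta>hat i 0 k = \<theta>hat0 i k) \<and> \<zeta> i 0 = \<zeta>0 i)"

definition bounded_signal :: "(real \<Rightarrow> real) \<Rightarrow> bool" where
  "bounded_signal f \<longleftrightarrow> bounded (f ` {0..})"

end

theory Submission
  imports Defs "HOL-Probability.Discrete_Topology"
begin

text \<open>Let \<open>F(k) = b \<integral> N + k\<close> and let \<open>V = z\<^sup>2/2 + |\<theta>hat - \<theta>|\<^sup>2/(2\<gamma>)\<close> for one agent. Along the
  closed loop \<open>V + \<nu> \<integral> z\<^sup>2 - F(\<zeta>)\<close> is constant, whatever the other agents do. As \<open>F\<close> takes
  arbitrarily negative values in both directions, \<open>\<zeta>\<close> cannot escape, so \<open>z\<close>, \<open>\<theta>hat\<close> and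
  \<open>\<zeta>\<close> are bounded and \<open>z\<close> is square integrable, with bounds depending on the initial data only.
  The integral states \<open>w\<close> then obey \<open>p' = - \<rho> L (p + z)\<close> for \<open>p = xbar - \<rho> w - c\<close> with
  \<open>c = \<omega> \<bullet> xbar\<close>. Here \<open>\<omega> \<bullet> p = 0\<close>, and the \<open>\<omega>\<close>-weighted energy of \<open>p\<close> is dissipated
  by the Dirichlet form of the graph, so \<open>p\<close> is bounded and square integrable too. Barbalat's lemma
  gives \<open>p, z \<longlongrightarrow> 0\<close>, that is \<open>x = p + z + c \<longlongrightarrow> c\<close>. Since the bounds hold on every
  interval of existence, they also yield global existence: truncate the vector field outside a large
  box and solve the truncated, globally Lipschitz system.\<close>

section \<open>Functions that are Lipschitz on boxes\<close>

text \<open>The classical Nussbaum argument lets \<open>\<zeta>\<close> grow without bound and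
  contradicts the limsup and liminf of the averaged gain. It starts from a solution that already
  exists and yields no bound in terms of the data. Explicit barrier points for \<open>F\<close> on
  both sides of \<open>\<zeta>(0)\<close> give such a bound, uniformly in the length of the time
  interval. The signs of the \<open>b i\<close> may differ, so a joint energy of all agents would
  contain several Nussbaum terms that could cancel each other. Separate energies avoid this. They
  are available because \<open>\<zeta>'\<close> contains \<open>z\<close> times the network
  coupling: the coupling cancels exactly and needs no estimate. What remains is a cascade, first
  \<open>z\<close> and then \<open>p\<close> driven by \<open>z\<close>. The formula
  \<open>x = p + z + c\<close> is the definition of \<open>z\<close> rewritten, and \<open>c\<close>
  drops out of the differences in \<open>p'\<close>. The weighted mean of \<open>p\<close> is
  conserved because \<open>\<omega>\<close> annihilates the Laplacian, and it starts at 0 because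
  \<open>c\<close> is the weighted mean of \<open>xbar\<close> and the weights sum to 1.\<close>

definition lipschitz_on_boxes :: "'k set \<Rightarrow> (('k \<Rightarrow> real) \<Rightarrow> real) \<Rightarrow> bool" where
  "lipschitz_on_boxes J g \<longleftrightarrow>
     (\<forall>R. \<exists>L. \<forall>a b. (\<forall>j\<in>J. \<bar>a j\<bar> \<le> R \<and> \<bar>b j\<bar> \<le> R) \<longrightarrow>
        \<bar>g a - g b\<bar> \<le> L * (\<Sum>j\<in>J. \<bar>a j - b j\<bar>))"

lemma lipschitz_on_boxesE:
  assumes "lipschitz_on_boxes J g"
  obtains L where "L \<ge> 0" "\<And>a b. (\<And>j. j \<in> J \<Longrightarrow> \<bar>a j\<bar> \<le> R \<and> \<bar>b j\<bar> \<le> R) \<Longrightarrow>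
    \<bar>g a - g b\<bar> \<le> L * (\<Sum>j\<in>J. \<bar>a j - b j\<bar>)"
proof -
  obtain L where L: "\<And>a b. (\<And>j. j \<in> J \<Longrightarrow> \<bar>a j\<bar> \<le> R \<and> \<bar>b j\<bar> \<le> R) \<Longrightarrow>
      \<bar>g a - g b\<bar> \<le> L * (\<Sum>j\<in>J. \<bar>a j - b j\<bar>)"
    using assms unfolding lipschitz_on_boxes_def by metis
  show thesis
  proof (rule that)
    show "max 0 L \<ge> 0" by simp
    fix a b assume "\<And>j. j \<in> J \<Longrightarrow> \<bar>a j\<bar> \<le> R \<and> \<bar>b j\<bar> \<le> R"
    from L[OF this] show "\<bar>g a - g b\<bar> \<le> max 0 L * (\<Sum>j\<in>J. \<bar>a j - b j\<bar>)"
      by (rule order_trans) (auto intro!: mult_right_mono sum_nonneg)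
  qed
qed

text \<open>Comparison with the value at the origin gives the bound; the box is enlarged to
  \<open>max 0 R\<close> so that it contains the origin even for negative \<open>R\<close>. Products
  and compositions use this bound next to the Lipschitz constant, and later it bounds inputs and
  derivatives along trajectories.\<close>

lemma lipschitz_on_boxes_bounded:
  assumes "lipschitz_on_boxes J g"
  obtains B where "B \<ge> 0" "\<And>a. (\<And>j. j \<in> J \<Longrightarrow> \<bar>a j\<bar> \<le> R) \<Longrightarrow> \<bar>g a\<bar> \<le> B"
proof -
  obtain L where L: "L \<ge> 0" "\<And>a b. (\<And>j. j \<in> J \<Longrightarrow> \<bar>a j\<bar> \<le> max 0 R \<and> \<bar>b j\<bar> \<le> max 0 R) \<Longrightarrow>
      \<bar>g a - g b\<bar> \<le> L * (\<Sum>j\<in>J. \<bar>a j - b j\<bar>)"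
    by (rule lipschitz_on_boxesE[OF assms, where R = "max 0 R"]) (rule that, assumption, blast)
  show thesis
  proof (rule that)
    fix a assume a: "\<And>j. j \<in> J \<Longrightarrow> \<bar>a j\<bar> \<le> R"
    have "\<bar>g a - g (\<lambda>_. 0)\<bar> \<le> L * (\<Sum>j\<in>J. \<bar>a j - 0\<bar>)"
      by (rule L) (use a in \<open>auto simp: le_max_iff_disj\<close>)
    also have "\<dots> \<le> L * (\<Sum>j\<in>J. max 0 R)"
      by (intro mult_left_mono sum_mono) (use a L in \<open>auto simp: le_max_iff_disj\<close>)
    finally show "\<bar>g a\<bar> \<le> \<bar>g (\<lambda>_. 0)\<bar> + L * (\<Sum>j\<in>J. max 0 R)" by linarith
  qed (use L in \<open>auto intro!: add_nonneg_nonneg mult_nonneg_nonneg\<close>)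
qed

lemma lipschitz_on_boxesI:
  assumes "\<And>R. \<exists>L. \<forall>a b. (\<forall>j\<in>J. \<bar>a j\<bar> \<le> R \<and> \<bar>b j\<bar> \<le> R) \<longrightarrow>
     \<bar>g a - g b\<bar> \<le> L * (\<Sum>j\<in>J. \<bar>a j - b j\<bar>)"
  shows "lipschitz_on_boxes J g"
  using assms unfolding lipschitz_on_boxes_def by blast

lemma lipschitz_on_boxes_const: "lipschitz_on_boxes J (\<lambda>_. c)"
  by (rule lipschitz_on_boxesI) (auto intro!: exI[of _ 0])

lemma lipschitz_on_boxes_coord:
  assumes "finite J" "j \<in> J"
  shows "lipschitz_on_boxes J (\<lambda>a. a j)"
proof (intro lipschitz_on_boxesI exI[of _ 1] allI impI)
  fix a b :: "'a \<Rightarrow> real"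
  show "\<bar>a j - b j\<bar> \<le> 1 * (\<Sum>j\<in>J. \<bar>a j - b j\<bar>)"
    using member_le_sum[OF assms(2), of "\<lambda>j. \<bar>a j - b j\<bar>"] assms(1) by simp
qed

lemma lipschitz_on_boxes_add:
  assumes "lipschitz_on_boxes J g" "lipschitz_on_boxes J h"
  shows "lipschitz_on_boxes J (\<lambda>a. g a + h a)"
proof (rule lipschitz_on_boxesI)
  fix R
  obtain L where L: "L \<ge> 0" "\<And>a b. (\<And>j. j \<in> J \<Longrightarrow> \<bar>a j\<bar> \<le> R \<and> \<bar>b j\<bar> \<le> R) \<Longrightarrow>
      \<bar>g a - g b\<bar> \<le> L * (\<Sum>j\<in>J. \<bar>a j - b j\<bar>)"
    by (rule lipschitz_on_boxesE[OF assms(1), where R = R]) (rule that, assumption, blast)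
  obtain M where M: "M \<ge> 0" "\<And>a b. (\<And>j. j \<in> J \<Longrightarrow> \<bar>a j\<bar> \<le> R \<and> \<bar>b j\<bar> \<le> R) \<Longrightarrow>
      \<bar>h a - h b\<bar> \<le> M * (\<Sum>j\<in>J. \<bar>a j - b j\<bar>)"
    by (rule lipschitz_on_boxesE[OF assms(2), where R = R]) (rule that, assumption, blast)
  show "\<exists>L. \<forall>a b. (\<forall>j\<in>J. \<bar>a j\<bar> \<le> R \<and> \<bar>b j\<bar> \<le> R) \<longrightarrow>
      \<bar>g a + h a - (g b + h b)\<bar> \<le> L * (\<Sum>j\<in>J. \<bar>a j - b j\<bar>)"
  proof (intro exI[of _ "L + M"] allI impI)
    fix a b assume "\<forall>j\<in>J. \<bar>a j\<bar> \<le> R \<and> \<bar>b j\<bar> \<le> R"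
    then show "\<bar>g a + h a - (g b + h b)\<bar> \<le> (L + M) * (\<Sum>j\<in>J. \<bar>a j - b j\<bar>)"
      using L(2)[of a b] M(2)[of a b] unfolding distrib_right by fastforce
  qed
qed

lemma lipschitz_on_boxes_mult:
  assumes "lipschitz_on_boxes J g" "lipschitz_on_boxes J h"
  shows "lipschitz_on_boxes J (\<lambda>a. g a * h a)"
proof (rule lipschitz_on_boxesI)
  fix R
  obtain L where L: "L \<ge> 0" "\<And>a b. (\<And>j. j \<in> J \<Longrightarrow> \<bar>a j\<bar> \<le> R \<and> \<bar>b j\<bar> \<le> R) \<Longrightarrow>
      \<bar>g a - g b\<bar> \<le> L * (\<Sum>j\<in>J. \<bar>a j - b j\<bar>)"
    by (rule lipschitz_on_boxesE[OF assms(1), where R = R]) (rule that, assumption, blast)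
  obtain M where M: "M \<ge> 0" "\<And>a b. (\<And>j. j \<in> J \<Longrightarrow> \<bar>a j\<bar> \<le> R \<and> \<bar>b j\<bar> \<le> R) \<Longrightarrow>
      \<bar>h a - h b\<bar> \<le> M * (\<Sum>j\<in>J. \<bar>a j - b j\<bar>)"
    by (rule lipschitz_on_boxesE[OF assms(2), where R = R]) (rule that, assumption, blast)
  obtain B where B: "B \<ge> 0" "\<And>a. (\<And>j. j \<in> J \<Longrightarrow> \<bar>a j\<bar> \<le> R) \<Longrightarrow> \<bar>g a\<bar> \<le> B"
    by (rule lipschitz_on_boxes_bounded[OF assms(1), where R = R]) (rule that, assumption, blast)
  obtain C where C: "C \<ge> 0" "\<And>a. (\<And>j. j \<in> J \<Longrightarrow> \<bar>a j\<bar> \<le> R) \<Longrightarrow> \<bar>h a\<bar> \<le> C"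
    by (rule lipschitz_on_boxes_bounded[OF assms(2), where R = R]) (rule that, assumption, blast)
  show "\<exists>L. \<forall>a b. (\<forall>j\<in>J. \<bar>a j\<bar> \<le> R \<and> \<bar>b j\<bar> \<le> R) \<longrightarrow>
      \<bar>g a * h a - g b * h b\<bar> \<le> L * (\<Sum>j\<in>J. \<bar>a j - b j\<bar>)"
  proof (intro exI[of _ "B * M + L * C"] allI impI)
    fix a b assume ab: "\<forall>j\<in>J. \<bar>a j\<bar> \<le> R \<and> \<bar>b j\<bar> \<le> R"
    define S where "S = (\<Sum>j\<in>J. \<bar>a j - b j\<bar>)"
    have S: "S \<ge> 0" by (auto simp: S_def intro: sum_nonneg)
    have "g a * h a - g b * h b = g a * (h a - h b) + (g a - g b) * h b"
      by (simp add: algebra_simps)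
    then have "\<bar>g a * h a - g b * h b\<bar> \<le> \<bar>g a\<bar> * \<bar>h a - h b\<bar> + \<bar>g a - g b\<bar> * \<bar>h b\<bar>"
      using abs_triangle_ineq[of "g a * (h a - h b)" "(g a - g b) * h b"] by (simp add: abs_mult)
    also have "\<dots> \<le> B * (M * S) + (L * S) * C"
      using L M B C S ab unfolding S_def by (intro add_mono mult_mono) auto
    finally show "\<bar>g a * h a - g b * h b\<bar> \<le> (B * M + L * C) * (\<Sum>j\<in>J. \<bar>a j - b j\<bar>)"
      by (simp add: S_def algebra_simps)
  qed
qed

lemma lipschitz_on_boxes_diff:
  assumes "lipschitz_on_boxes J g" "lipschitz_on_boxes J h"
  shows "lipschitz_on_boxes J (\<lambda>a. g a - h a)"
  using lipschitz_on_boxes_add[OF assms(1) lipschitz_on_boxes_mult[OF lipschitz_on_boxes_const[of _ "-1"] assms(2)]]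
  by simp

lemma lipschitz_on_boxes_sum:
  assumes "\<And>i. i \<in> I \<Longrightarrow> lipschitz_on_boxes J (g i)"
  shows "lipschitz_on_boxes J (\<lambda>a. \<Sum>i\<in>I. g i a)"
  using assms
  by (induction I rule: infinite_finite_induct)
    (auto intro: lipschitz_on_boxes_const lipschitz_on_boxes_add)

text \<open>On a box \<open>g\<close> takes values in a compact interval, where the continuous
  \<open>h'\<close> is bounded, and the mean value inequality does the rest. This covers
  \<open>nussbaum\<close> and the smooth regressors, which need not be globally Lipschitz.\<close>

lemma lipschitz_on_boxes_compose:
  fixes h h' :: "real \<Rightarrow> real"
  assumes g: "lipschitz_on_boxes J g"
    and h: "\<And>x. (h has_real_derivative h' x) (at x)" "continuous_on UNIV h'"
  shows "lipschitz_on_boxes J (\<lambda>a. h (g a))"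
proof (rule lipschitz_on_boxesI)
  fix R
  obtain L where L: "L \<ge> 0" "\<And>a b. (\<And>j. j \<in> J \<Longrightarrow> \<bar>a j\<bar> \<le> R \<and> \<bar>b j\<bar> \<le> R) \<Longrightarrow>
      \<bar>g a - g b\<bar> \<le> L * (\<Sum>j\<in>J. \<bar>a j - b j\<bar>)"
    by (rule lipschitz_on_boxesE[OF g, where R = R]) (rule that, assumption, blast)
  obtain B where B: "B \<ge> 0" "\<And>a. (\<And>j. j \<in> J \<Longrightarrow> \<bar>a j\<bar> \<le> R) \<Longrightarrow> \<bar>g a\<bar> \<le> B"
    by (rule lipschitz_on_boxes_bounded[OF g, where R = R]) (rule that, assumption, blast)
  have "bounded (h' ` {-B..B})"
    by (intro compact_imp_bounded compact_continuous_image continuous_on_subset[OF h(2)]) auto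
  then obtain D where D: "D > 0" "\<And>x. x \<in> {-B..B} \<Longrightarrow> \<bar>h' x\<bar> \<le> D"
    by (auto simp: bounded_pos)
  show "\<exists>L. \<forall>a b. (\<forall>j\<in>J. \<bar>a j\<bar> \<le> R \<and> \<bar>b j\<bar> \<le> R) \<longrightarrow>
      \<bar>h (g a) - h (g b)\<bar> \<le> L * (\<Sum>j\<in>J. \<bar>a j - b j\<bar>)"
  proof (intro exI[of _ "D * L"] allI impI)
    fix a b assume ab: "\<forall>j\<in>J. \<bar>a j\<bar> \<le> R \<and> \<bar>b j\<bar> \<le> R"
    have "norm (h (g a) - h (g b)) \<le> D * norm (g a - g b)"
    proof (rule field_differentiable_bound)
      show "convex {-B..B}" by simp
      show "(h has_real_derivative h' x) (at x within {-B..B})" for x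
        by (rule has_field_derivative_at_within[OF h(1)])
      show "norm (h' x) \<le> D" if "x \<in> {-B..B}" for x using D(2)[OF that] by simp
      show "g a \<in> {-B..B}" "g b \<in> {-B..B}"
        using B(2)[of a] B(2)[of b] ab by (auto simp: abs_le_iff)
    qed
    also have "\<dots> \<le> D * (L * (\<Sum>j\<in>J. \<bar>a j - b j\<bar>))"
      using L(2)[of a b] ab D(1) by (intro mult_left_mono) auto
    finally show "\<bar>h (g a) - h (g b)\<bar> \<le> D * L * (\<Sum>j\<in>J. \<bar>a j - b j\<bar>)"
      by (simp add: mult.assoc)
  qed
qed

section \<open>Global solutions of ordinary differential equations\<close>

text \<open>The right end \<open>t + 1\<close> stays away from \<open>t\<close>, so near
  \<open>t\<close> the interval and the half-line are the same set. This carries the fundamental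
  theorem of calculus from compact intervals to the half-line.\<close>

lemma has_real_derivative_within_Icc_imp_Ici:
  fixes f :: "real \<Rightarrow> real"
  assumes "(f has_real_derivative D) (at t within {a..t + 1})"
  shows "(f has_real_derivative D) (at t within {a..})"
proof -
  have "at t within {a..t + 1} = at t within {a..}"
    by (rule at_within_nhd[of _ "{..<t + 1}"]) auto
  then show ?thesis using assms by simp
qed

lemma integral_has_real_derivative_Ici:
  fixes g :: "real \<Rightarrow> real"
  assumes "continuous_on {a..} g" "a \<le> t"
  shows "((\<lambda>t. integral {a..t} g) has_real_derivative g t) (at t within {a..})"
proof (rule has_real_derivative_within_Icc_imp_Ici)
  show "((\<lambda>t. integral {a..t} g) has_real_derivative g t) (at t within {a..t + 1})"
    by (rule integral_has_real_derivative)
      (use assms in \<open>auto intro: continuous_on_subset\<close>)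
qed

text \<open>A solution is a family of curves indexed by an arbitrary type. With the discrete
  topology on the indices the family becomes a single bounded continuous function of two arguments,
  so Banach's theorem applies in the complete space of such functions.\<close>

lemma continuous_on_discrete_times:
  fixes f :: "'k discrete \<times> real \<Rightarrow> real"
  assumes "\<And>n. continuous_on UNIV (\<lambda>t. f (n, t))"
  shows "continuous_on UNIV f"
proof -
  have "continuous_on (\<Union>n. {n} \<times> UNIV) f"
  proof (rule continuous_on_open_UN)
    show "open ({n} \<times> (UNIV :: real set))" for n :: "'k discrete"
      by (intro open_Times) (auto simp: open_discrete)
    show "continuous_on ({n} \<times> UNIV) f" for n
    proof -
      have "continuous_on ({n} \<times> UNIV) (\<lambda>p. f (n, snd p))"
        by (rule continuous_on_compose2[OF assms, of _ snd]) (auto intro: continuous_intros)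
      then show ?thesis
        by (rule continuous_on_eq) auto
    qed
  qed
  moreover have "(\<Union>n. {n} \<times> UNIV) = (UNIV :: ('k discrete \<times> real) set)"
    by auto
  ultimately show ?thesis by simp
qed

text \<open>Picard iteration in the weighted variable \<open>u j s = exp (- K * s) * (y j s - y0 j)\<close>: for \<open>K\<close> large
  the integral operator is a contraction in the supremum norm over the whole half-line.\<close>

lemma global_solution_of_lipschitz:
  fixes f :: "'k \<Rightarrow> ('k \<Rightarrow> real) \<Rightarrow> real"
  assumes "finite J"
    and "L \<ge> 0"
    and lip: "\<And>k a b. k \<in> J \<Longrightarrow> \<bar>f k a - f k b\<bar> \<le> L * (\<Sum>j\<in>J. \<bar>a j - b j\<bar>)"
    and bnd: "\<And>k a. k \<in> J \<Longrightarrow> \<bar>f k a\<bar> \<le> B"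
  shows "\<exists>y. \<forall>k\<in>J. y k 0 = y0 k \<and>
           (\<forall>t\<ge>0. (y k has_real_derivative f k (\<lambda>j. y j t)) (at t within {0..}))"
proof (cases "J = {}")
  case False
  then obtain k0 where "k0 \<in> J" by blast
  with bnd[of k0] have B0: "B \<ge> 0" using abs_ge_zero order_trans by blast
  \<comment> \<open>The contraction factor will be \<open>L * card J / K\<close>. This choice keeps
    it below 1/2, and the added 1 makes \<open>K\<close> positive when \<open>L = 0\<close>.\<close>
  define K where "K = 2 * L * card J + 1"
  have K: "K > 0" using \<open>L \<ge> 0\<close> by (simp add: K_def add_nonneg_pos)
  define Y where "Y u j s = y0 j + exp (K * s) * apply_bcontfun u (discrete j, s)"
    for u :: "('k discrete \<times> real) \<Rightarrow>\<^sub>C real" and j s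
  define G where "G u k s = f k (\<lambda>j. Y u j s)" for u k s
  have contY: "continuous_on UNIV (Y u j)" for u j
  proof -
    have "continuous_on UNIV (\<lambda>s. apply_bcontfun u (discrete j, s))"
      by (rule continuous_on_compose2[OF continuous_on_apply_bcontfun])
        (auto intro!: continuous_intros)
    then show ?thesis unfolding Y_def by (intro continuous_intros) auto
  qed
  have contG: "continuous_on UNIV (G u k)" if "k \<in> J" for u k
    unfolding continuous_on_def
  proof
    fix s :: real
    have "((\<lambda>r. L * (\<Sum>j\<in>J. \<bar>Y u j r - Y u j s\<bar>)) \<longlongrightarrow> L * (\<Sum>j\<in>J. \<bar>Y u j s - Y u j s\<bar>)) (at s)"
      using contY unfolding continuous_on_def by (intro tendsto_intros) auto
    then have lim: "((\<lambda>r. L * (\<Sum>j\<in>J. \<bar>Y u j r - Y u j s\<bar>)) \<longlongrightarrow> 0) (at s)" by simp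
    have "((\<lambda>r. G u k r - G u k s) \<longlongrightarrow> 0) (at s)"
      by (rule Lim_null_comparison[OF _ lim])
        (use lip[OF that] in \<open>auto simp: G_def\<close>)
    then show "(G u k \<longlongrightarrow> G u k s) (at s within UNIV)"
      using LIM_zero_cancel by blast
  qed
  have intG: "G u k integrable_on {a..b}" if "k \<in> J" for u k a b
    using contG[OF that] by (intro integrable_continuous_real) (auto intro: continuous_on_subset)
  have derG: "((\<lambda>t. integral {0..t} (G u k)) has_real_derivative G u k t) (at t within {0..})"
    if "k \<in> J" "t \<ge> 0" for u k t
    using contG[OF that(1)] that(2)
    by (intro integral_has_real_derivative_Ici) (auto intro: continuous_on_subset)
  \<comment> \<open>The function space covers the whole line and all indices, so the integral
    operator is extended by 0; \<open>max 0 t\<close> does this continuously for negative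
    times.\<close>
  define P where "P u = (\<lambda>(n, t). if of_discrete n \<in> J then
      exp (- K * max 0 t) * integral {0..max 0 t} (G u (of_discrete n)) else 0)" for u
  have P_bcontfun: "P u \<in> bcontfun" for u
  proof (rule bcontfun_normI)
    show "continuous_on UNIV (P u)"
    proof (rule continuous_on_discrete_times)
      fix n
      show "continuous_on UNIV (\<lambda>t. P u (n, t))"
      proof (cases "of_discrete n \<in> J")
        case True
        have "continuous_on {0..} (\<lambda>t. integral {0..t} (G u (of_discrete n)))"
          using derG[OF True] by (intro DERIV_continuous_on) auto
        then have "continuous_on UNIV (\<lambda>t. integral {0..max 0 t} (G u (of_discrete n)))"
          by (rule continuous_on_compose2) (auto intro!: continuous_intros)
        then show ?thesis using True by (auto simp: P_def intro!: continuous_intros)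
      qed (simp add: P_def)
    qed
    show "norm (P u p) \<le> B / K" for p
    proof -
      obtain n t0 where p: "p = (n, t0)" by (cases p)
      show ?thesis
      proof (cases "of_discrete n \<in> J")
        case True
        define t where "t = max 0 t0"
        have t: "t \<ge> 0" by (simp add: t_def)
        have "norm (integral {0..t} (G u (of_discrete n))) \<le> integral {0..t} (\<lambda>_. B)"
          by (rule integral_norm_bound_integral[OF intG[OF True]])
            (use bnd[OF True] in \<open>auto simp: G_def\<close>)
        then have "\<bar>integral {0..t} (G u (of_discrete n))\<bar> \<le> B * t"
          using t by (simp add: mult.commute)
        then have "norm (P u p) \<le> exp (- K * t) * (B * t)"
          using True by (simp add: P_def p t_def abs_mult mult_left_mono)
        \<comment> \<open>The weight absorbs the linear growth that the bound on \<open>f\<close>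
          permits: \<open>t\<close> is at most \<open>exp (K * t) / K\<close>, which leaves a bound
          independent of time.\<close>
        also have "\<dots> \<le> exp (- K * t) * (B * (exp (K * t) / K))"
        proof -
          have "K * t \<le> exp (K * t)" using exp_ge_add_one_self[of "K * t"] by linarith
          then have "t \<le> exp (K * t) / K" using K by (simp add: field_simps)
          then show ?thesis using B0 by (intro mult_left_mono) auto
        qed
        also have "\<dots> = B / K" by (simp add: exp_minus)
        finally show ?thesis .
      qed (use p B0 K in \<open>simp add: P_def\<close>)
    qed
  qed
  define \<Phi> where "\<Phi> u = Bcontfun (P u)" for u
  have \<Phi>: "apply_bcontfun (\<Phi> u) = P u" for u
    unfolding \<Phi>_def by (rule Bcontfun_inverse[OF P_bcontfun])
  have "dist (\<Phi> u) (\<Phi> v) \<le> 1/2 * dist u v" for u v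
  proof (rule dist_bound)
    fix p :: "'k discrete \<times> real"
    obtain n t0 where p: "p = (n, t0)" by (cases p)
    define D where "D = dist u v"
    have D: "\<bar>apply_bcontfun u q - apply_bcontfun v q\<bar> \<le> D" for q
      using dist_bounded[of u q v] by (simp add: D_def dist_real_def)
    have D0: "D \<ge> 0" by (simp add: D_def)
    show "dist (apply_bcontfun (\<Phi> u) p) (apply_bcontfun (\<Phi> v) p) \<le> 1/2 * dist u v"
    proof (cases "of_discrete n \<in> J")
      case True
      define k where "k = of_discrete n"
      have k: "k \<in> J" using True by (simp add: k_def)
      define t where "t = max 0 t0"
      have t: "t \<ge> 0" by (simp add: t_def)
      define M where "M = L * card J * D"
      have M0: "M \<ge> 0" using D0 \<open>L \<ge> 0\<close> by (simp add: M_def)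
      have pt: "\<bar>G u k s - G v k s\<bar> \<le> M * exp (K * s)" for s
      proof -
        have "\<bar>G u k s - G v k s\<bar> \<le> L * (\<Sum>j\<in>J. \<bar>Y u j s - Y v j s\<bar>)"
          unfolding G_def by (rule lip[OF k])
        also have "\<dots> \<le> L * (\<Sum>j\<in>J. exp (K * s) * D)"
        proof (intro mult_left_mono sum_mono \<open>L \<ge> 0\<close>)
          fix j
          have "Y u j s - Y v j s
            = exp (K * s) * (apply_bcontfun u (discrete j, s) - apply_bcontfun v (discrete j, s))"
            by (simp add: Y_def algebra_simps)
          then show "\<bar>Y u j s - Y v j s\<bar> \<le> exp (K * s) * D"
            using D[of "(discrete j, s)"] by (simp add: abs_mult)
        qed
        also have "\<dots> = M * exp (K * s)" by (simp add: M_def)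
        finally show ?thesis .
      qed
      have hi: "((\<lambda>s. M * exp (K * s)) has_integral M * exp (K * t) / K - M * exp (K * 0) / K) {0..t}"
        by (rule fundamental_theorem_of_calculus[OF t])
          (use K in \<open>auto simp flip: has_real_derivative_iff_has_vector_derivative
             intro!: derivative_eq_intros\<close>)
      have "\<bar>integral {0..t} (G u k) - integral {0..t} (G v k)\<bar>
          = norm (integral {0..t} (\<lambda>s. G u k s - G v k s))"
        using intG[OF k] by (simp add: integral_diff)
      also have "\<dots> \<le> integral {0..t} (\<lambda>s. M * exp (K * s))"
        by (rule integral_norm_bound_integral)
          (use pt has_integral_integrable[OF hi] intG[OF k] in \<open>auto intro!: integrable_diff\<close>)
      also have "\<dots> = M * exp (K * t) / K - M / K" using integral_unique[OF hi] by simp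
      also have "\<dots> \<le> M * exp (K * t) / K" using M0 K by simp
      finally have "exp (- K * t) * \<bar>integral {0..t} (G u k) - integral {0..t} (G v k)\<bar>
          \<le> exp (- K * t) * (M * exp (K * t) / K)"
        by (intro mult_left_mono) auto
      then have "dist (P u p) (P v p) \<le> exp (- K * t) * (M * exp (K * t) / K)"
        using True by (simp add: P_def p t_def k_def dist_real_def abs_mult
            flip: right_diff_distrib)
      also have "\<dots> = M / K" by (simp add: exp_minus)
      also have "\<dots> \<le> 1/2 * D"
        using K D0 by (simp add: M_def K_def field_simps)
      finally show ?thesis by (simp add: \<Phi> D_def)
    qed (simp add: \<Phi> P_def p)
  qed
  then obtain u where u: "\<Phi> u = u"
    using banach_fix_type[of "1/2" \<Phi>] by auto
  have sol: "Y u k t = y0 k + integral {0..t} (G u k)" if "k \<in> J" "t \<ge> 0" for k t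
  proof -
    have "apply_bcontfun u (discrete k, t) = P u (discrete k, t)" using \<Phi>[of u] u by simp
    also have "\<dots> = exp (- K * t) * integral {0..t} (G u k)"
      using that by (simp add: P_def discrete_inverse)
    finally show ?thesis by (simp add: Y_def exp_minus)
  qed
  show ?thesis
  proof (intro exI[of _ "Y u"] ballI conjI allI impI)
    fix k t assume k: "k \<in> J"
    show "Y u k 0 = y0 k" using sol[OF k, of 0] by simp
    assume t: "(t::real) \<ge> 0"
    have "((\<lambda>t. y0 k + integral {0..t} (G u k)) has_real_derivative G u k t) (at t within {0..})"
      using derG[OF k t] by (auto intro!: derivative_eq_intros)
    then have "(Y u k has_real_derivative G u k t) (at t within {0..})"
      by (rule has_field_derivative_transform_within[of _ _ _ _ 1]) (use sol[OF k] t in auto)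
    then show "(Y u k has_real_derivative f k (\<lambda>j. Y u j t)) (at t within {0..})"
      by (simp add: G_def)
  qed
qed simp

text \<open>The a priori bound speaks only of solutions of the original equation. A solution of the
  truncated system is one of these as long as it stays in the box of radius \<open>R\<close>, and at
  its first contact with the boundary the bound would place it within \<open>C < R\<close>. So the
  truncation never becomes active.\<close>

lemma global_solution_of_apriori_bound:
  fixes f :: "'k \<Rightarrow> ('k \<Rightarrow> real) \<Rightarrow> real"
  assumes J: "finite J"
    and lip: "\<And>k. k \<in> J \<Longrightarrow> lipschitz_on_boxes J (f k)"
    and apriori: "\<And>T y. T \<ge> 0 \<Longrightarrow> (\<And>k. k \<in> J \<Longrightarrow> y k 0 = y0 k) \<Longrightarrow>
        (\<And>k t. k \<in> J \<Longrightarrow> t \<in> {0..T} \<Longrightarrow>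
           (y k has_real_derivative f k (\<lambda>j. y j t)) (at t within {0..T})) \<Longrightarrow>
        (\<And>k. k \<in> J \<Longrightarrow> \<bar>y k T\<bar> \<le> C)"
  shows "\<exists>y. \<forall>k\<in>J. y k 0 = y0 k \<and>
           (\<forall>t\<ge>0. (y k has_real_derivative f k (\<lambda>j. y j t)) (at t within {0..}))"
proof -
  \<comment> \<open>Strictly above \<open>C\<close>, so that touching the boundary is contradictory,
    and positive, so that the box contains the origin, from which \<open>B\<close> is
    computed.\<close>
  define R where "R = max 0 C + 1"
  have R: "R > 0" "C < R" by (auto simp: R_def)
  define clamp where "clamp a = (\<lambda>j. max (- R) (min R (a j)))" for a :: "'k \<Rightarrow> real"
  have clamp_le: "\<bar>clamp a j\<bar> \<le> R" for a j using R by (auto simp: clamp_def)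
  have clamp_id: "clamp a j = a j" if "\<bar>a j\<bar> \<le> R" for a j using that by (auto simp: clamp_def)
  have "\<forall>k\<in>J. \<exists>M\<ge>0. \<forall>a b. (\<forall>j\<in>J. \<bar>a j\<bar> \<le> R \<and> \<bar>b j\<bar> \<le> R) \<longrightarrow>
      \<bar>f k a - f k b\<bar> \<le> M * (\<Sum>j\<in>J. \<bar>a j - b j\<bar>)"
  proof
    fix k assume "k \<in> J"
    then obtain M where "M \<ge> 0" "\<And>a b. (\<And>j. j \<in> J \<Longrightarrow> \<bar>a j\<bar> \<le> R \<and> \<bar>b j\<bar> \<le> R) \<Longrightarrow>
        \<bar>f k a - f k b\<bar> \<le> M * (\<Sum>j\<in>J. \<bar>a j - b j\<bar>)"
      by (rule lipschitz_on_boxesE[OF lip, where R = R]) (rule that, assumption, blast)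
    then show "\<exists>M\<ge>0. \<forall>a b. (\<forall>j\<in>J. \<bar>a j\<bar> \<le> R \<and> \<bar>b j\<bar> \<le> R) \<longrightarrow>
        \<bar>f k a - f k b\<bar> \<le> M * (\<Sum>j\<in>J. \<bar>a j - b j\<bar>)" by blast
  qed
  then obtain M where M: "\<forall>k\<in>J. M k \<ge> 0 \<and> (\<forall>a b. (\<forall>j\<in>J. \<bar>a j\<bar> \<le> R \<and> \<bar>b j\<bar> \<le> R) \<longrightarrow>
      \<bar>f k a - f k b\<bar> \<le> M k * (\<Sum>j\<in>J. \<bar>a j - b j\<bar>))"
    unfolding bchoice_iff by blast
  define L where "L = (\<Sum>k\<in>J. M k)"
  have L0: "L \<ge> 0" unfolding L_def using M by (intro sum_nonneg) auto
  have L: "\<bar>f k a - f k b\<bar> \<le> L * (\<Sum>j\<in>J. \<bar>a j - b j\<bar>)"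
    if "k \<in> J" "\<And>j. j \<in> J \<Longrightarrow> \<bar>a j\<bar> \<le> R \<and> \<bar>b j\<bar> \<le> R" for k a b
  proof -
    have "\<bar>f k a - f k b\<bar> \<le> M k * (\<Sum>j\<in>J. \<bar>a j - b j\<bar>)" using M that by blast
    also have "\<dots> \<le> L * (\<Sum>j\<in>J. \<bar>a j - b j\<bar>)"
      unfolding L_def using M that J
      by (intro mult_right_mono member_le_sum sum_nonneg) auto
    finally show ?thesis .
  qed
  define B where "B = (\<Sum>k\<in>J. \<bar>f k (\<lambda>_. 0)\<bar>) + L * (\<Sum>j\<in>J. R)"
  have "\<exists>y. \<forall>k\<in>J. y k 0 = y0 k \<and>
      (\<forall>t\<ge>0. (y k has_real_derivative f k (clamp (\<lambda>j. y j t))) (at t within {0..}))"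
  proof (rule global_solution_of_lipschitz[OF J, of L "\<lambda>k a. f k (clamp a)" B])
    show "L \<ge> 0" by (rule L0)
    fix k a b assume k: "k \<in> J"
    have "\<bar>f k (clamp a) - f k (clamp b)\<bar> \<le> L * (\<Sum>j\<in>J. \<bar>clamp a j - clamp b j\<bar>)"
      by (rule L[OF k]) (use clamp_le in auto)
    also have "\<dots> \<le> L * (\<Sum>j\<in>J. \<bar>a j - b j\<bar>)"
      by (intro mult_left_mono sum_mono) (auto simp: clamp_def L0)
    finally show "\<bar>f k (clamp a) - f k (clamp b)\<bar> \<le> L * (\<Sum>j\<in>J. \<bar>a j - b j\<bar>)" .
    have "\<bar>f k (clamp a) - f k (\<lambda>_. 0)\<bar> \<le> L * (\<Sum>j\<in>J. \<bar>clamp a j - 0\<bar>)"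
      by (rule L[OF k]) (use clamp_le R in auto)
    also have "\<dots> \<le> L * (\<Sum>j\<in>J. R)"
      by (intro mult_left_mono sum_mono) (use clamp_le L0 in auto)
    finally have 1: "\<bar>f k (clamp a) - f k (\<lambda>_. 0)\<bar> \<le> L * (\<Sum>j\<in>J. R)" .
    have "\<bar>f k (\<lambda>_. 0)\<bar> \<le> (\<Sum>k\<in>J. \<bar>f k (\<lambda>_. 0)\<bar>)"
      by (rule member_le_sum[OF k]) (use J in auto)
    with 1 show "\<bar>f k (clamp a)\<bar> \<le> B" unfolding B_def by linarith
  qed
  then obtain y where y0: "\<And>k. k \<in> J \<Longrightarrow> y k 0 = y0 k"
    and y: "\<And>k t. k \<in> J \<Longrightarrow> t \<ge> 0 \<Longrightarrow>
      (y k has_real_derivative f k (clamp (\<lambda>j. y j t))) (at t within {0..})" by blast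
  \<comment> \<open>\<open>clamp\<close> also alters coordinates outside \<open>J\<close>, about
    which nothing is known. The Lipschitz estimate sees only coordinates in \<open>J\<close>, so it
    still identifies the two values.\<close>
  have f_clamp: "f k (clamp (\<lambda>j. y j t)) = f k (\<lambda>j. y j t)"
    if "k \<in> J" "\<And>j. j \<in> J \<Longrightarrow> \<bar>y j t\<bar> \<le> R" for k t
  proof -
    have "\<bar>f k (clamp (\<lambda>j. y j t)) - f k (\<lambda>j. y j t)\<bar>
        \<le> L * (\<Sum>j\<in>J. \<bar>clamp (\<lambda>j. y j t) j - y j t\<bar>)"
      by (rule L[OF that(1)]) (use that clamp_le in auto)
    also have "(\<Sum>j\<in>J. \<bar>clamp (\<lambda>j. y j t) j - y j t\<bar>) = 0"
      by (rule sum.neutral) (use that clamp_id[of "\<lambda>j. y j t"] in auto)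
    finally show ?thesis by simp
  qed
  have cont: "continuous_on {0..} (y k)" if "k \<in> J" for k
    using y[OF that] by (intro DERIV_continuous_on) auto
  have le: "\<bar>y k t\<bar> \<le> R" if k: "k \<in> J" and t: "t \<ge> 0" for k t
  proof (rule ccontr)
    assume not_le: "\<not> \<bar>y k t\<bar> \<le> R"
    \<comment> \<open>The times at which some coordinate has reached the boundary. \<open>S\<close>
      is closed as a finite union of closed sets, so its infimum is attained and is the first
      contact time.\<close>
    define S where "S = (\<Union>k\<in>J. {t\<in>{0..}. R \<le> \<bar>y k t\<bar>})"
    have "closed {t\<in>{0..}. R \<le> \<bar>y k t\<bar>}" if "k \<in> J" for k
      using cont[OF that] by (intro continuous_on_closed_Collect_le continuous_intros) auto
    then have "closed S" unfolding S_def using J by (intro closed_UN) auto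
    moreover have "t \<in> S" using k t not_le by (auto simp: S_def intro!: bexI[of _ k])
    moreover have bdd: "bdd_below S" by (rule bdd_belowI[of _ 0]) (auto simp: S_def)
    ultimately have inf: "Inf S \<in> S" using closed_contains_Inf[of S] by blast
    define T where "T = Inf S"
    obtain i where i: "i \<in> J" "T \<ge> 0" "R \<le> \<bar>y i T\<bar>" using inf by (auto simp: S_def T_def)
    have less: "\<bar>y j s\<bar> < R" if "j \<in> J" "0 \<le> s" "s < T" for j s
    proof -
      have "s \<notin> S" using cInf_lower[OF _ bdd, of s] that by (auto simp: T_def)
      then show ?thesis using that by (auto simp: S_def)
    qed
    have le_T: "\<bar>y j s\<bar> \<le> R" if "j \<in> J" "s \<in> {0..T}" for j s
    proof (cases "T = 0")
      \<comment> \<open>At time 0 there is no left limit to use. The a priori bound is applied on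
        \<open>{0..0}\<close>, where the differential equation is vacuous because the filter is
        trivial.\<close>
      case True
      have "\<bar>y j 0\<bar> \<le> C"
      proof (rule apriori[OF order_refl, of y j, OF y0 _ that(1)])
        show "(y k has_real_derivative f k (\<lambda>j. y j t)) (at t within {0..0})"
          if "t \<in> {0..0}" for k t
          using that by (simp add: has_field_derivative_iff at_within_def)
      qed
      then show ?thesis using that True R by auto
    next
      case False
      show ?thesis
      proof (cases "s = T")
        case True
        have "((\<lambda>s. \<bar>y j s\<bar>) \<longlongrightarrow> \<bar>y j T\<bar>) (at T within {0..<T})"
          using cont[OF that(1)] i(2) unfolding continuous_on_def
          by (intro tendsto_intros) (auto intro: tendsto_within_subset)
        then have "\<bar>y j T\<bar> \<le> R"
        proof (rule tendsto_upperbound)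
          show "\<forall>\<^sub>F s in at T within {0..<T}. \<bar>y j s\<bar> \<le> R"
            using less[OF that(1)]
            by (auto simp: eventually_at_filter intro!: always_eventually less_imp_le)
          show "at T within {0..<T} \<noteq> bot"
            using \<open>T \<noteq> 0\<close> i(2) by (simp add: at_within_eq_bot_iff)
        qed
        then show ?thesis using True by simp
      next
        case False
        then show ?thesis using less[of j s] that by auto
      qed
    qed
    have "\<bar>y i T\<bar> \<le> C"
    proof (rule apriori[OF i(2), of y i, OF y0 _ i(1)])
      fix k t assume "k \<in> J" "t \<in> {0..T}"
      then show "(y k has_real_derivative f k (\<lambda>j. y j t)) (at t within {0..T})"
        using y[of k t] f_clamp[of k t] le_T by (auto intro: DERIV_subset)
    qed
    with i R show False by linarith
  qed
  show ?thesis
  proof (intro exI[of _ y] ballI conjI allI impI)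
    fix k t assume "k \<in> J" "(t::real) \<ge> 0"
    then show "(y k has_real_derivative f k (\<lambda>j. y j t)) (at t within {0..})"
      using y[of k t] f_clamp[of k t] le by auto
  qed (use y0 in auto)
qed

section \<open>Barbalat's lemma\<close>

text \<open>A value of at least \<open>e\<close> keeps \<open>g\<close> above \<open>e / 2\<close>
  for a fixed time \<open>d\<close>, because the slope is bounded. Such a bump adds at least
  \<open>e / 2 * d\<close> to the integral, which is nondecreasing and bounded and so eventually has
  less than that left.\<close>

lemma tendsto_zero_of_bounded_integral:
  fixes g :: "real \<Rightarrow> real"
  assumes der: "\<And>t. t \<ge> 0 \<Longrightarrow> (g has_real_derivative g' t) (at t within {0..})"
    and g': "\<And>t. t \<ge> 0 \<Longrightarrow> \<bar>g' t\<bar> \<le> K"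
    and nonneg: "\<And>t. t \<ge> 0 \<Longrightarrow> g t \<ge> 0"
    and bnd: "\<And>T. T \<ge> 0 \<Longrightarrow> integral {0..T} g \<le> C"
  shows "(g \<longlongrightarrow> 0) at_top"
proof (rule tendstoI)
  fix e :: real assume e: "e > 0"
  have cont: "continuous_on {0..} g"
    using der by (intro DERIV_continuous_on) auto
  have int: "g integrable_on {a..b}" if "a \<ge> 0" for a b
    using that by (intro integrable_continuous_real continuous_on_subset[OF cont]) auto
  define G where "G t = integral {0..t} g" for t
  \<comment> \<open>A slope of \<open>\<bar>K\<bar> + 1\<close> changes \<open>g\<close> by exactly
    \<open>e / 2\<close> in time \<open>d\<close>; the 1 avoids a division by 0.\<close>
  define d where "d = e / (2 * (\<bar>K\<bar> + 1))"
  have d: "d > 0" using e by (simp add: d_def add_nonneg_pos)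
  have split: "G t = G s + integral {s..t} g" if "0 \<le> s" "s \<le> t" for s t
    using Henstock_Kurzweil_Integration.integral_combine[OF that int[of 0 t]] unfolding G_def by simp
  have mono: "G s \<le> G t" if "0 \<le> s" "s \<le> t" for s t
  proof -
    have "integral {s..t} g \<ge> 0"
      using that nonneg by (intro integral_nonneg int) auto
    then show ?thesis using split[OF that] by simp
  qed
  have bdd: "bdd_above (G ` {0..})"
    using bnd by (auto intro!: bdd_aboveI[of _ C] simp: G_def)
  define S where "S = Sup (G ` {0..})"
  have "S - e / 2 * d < S" using e d by simp
  then obtain t0 where t0: "t0 \<ge> 0" "S - e / 2 * d < G t0"
    using less_cSup_iff[OF _ bdd, of "S - e / 2 * d"] by (auto simp: S_def)
  have "g t < e" if t: "t \<ge> t0" for t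
  proof (rule ccontr)
    assume "\<not> g t < e"
    then have ge: "g t \<ge> e" by simp
    have "e / 2 \<le> g s" if s: "s \<in> {t..t + d}" for s
    proof -
      have "norm (g s - g t) \<le> \<bar>K\<bar> * norm (s - t)"
      proof (rule field_differentiable_bound)
        show "convex {0::real..}" by simp
        show "(g has_real_derivative g' x) (at x within {0..})" if "x \<in> {0..}" for x
          using der that by simp
        show "norm (g' x) \<le> \<bar>K\<bar>" if "x \<in> {0..}" for x using g'[of x] that by simp
      qed (use s t t0 in auto)
      also have "\<dots> \<le> (\<bar>K\<bar> + 1) * d" using s by (intro mult_mono) auto
      also have "\<dots> = e / 2" by (simp add: d_def field_simps)
      finally have "\<bar>g s - g t\<bar> \<le> e / 2" by simp
      then show ?thesis using ge by linarith
    qed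
    then have "integral {t..t + d} (\<lambda>_. e / 2) \<le> integral {t..t + d} g"
      using t t0 by (intro integral_le int) auto
    then have "G (t + d) \<ge> G t + e / 2 * d"
      using split[of t "t + d"] t t0 d by (simp add: mult.commute)
    moreover have "G (t + d) \<le> S"
      unfolding S_def by (rule cSup_upper[OF _ bdd]) (use t t0 d in auto)
    ultimately show False using t0 mono[OF t0(1) t] by linarith
  qed
  then show "\<forall>\<^sub>F t in at_top. dist (g t) 0 < e"
    using nonneg t0
    by (intro eventually_at_top_linorderI[of t0]) (auto simp: dist_real_def)
qed

section \<open>A single agent\<close>

text \<open>The antiderivative of \<open>nussbaum\<close> that vanishes at 0, obtained by
  integrating by parts twice.\<close>

definition nussbaum_integral :: "real \<Rightarrow> real" where
  "nussbaum_integral k = k\<^sup>2 * sin k + 2 * k * cos k - 2 * sin k"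

lemma DERIV_nussbaum_integral:
  "(nussbaum_integral has_real_derivative nussbaum k) (at k)"
  unfolding nussbaum_integral_def[abs_def] nussbaum_def
  by (auto intro!: derivative_eq_intros simp: algebra_simps power2_eq_square)

text \<open>Where \<open>cos k = 0\<close> and \<open>sin k = - sgn b\<close>, the expression equals
  \<open>- \<bar>b\<bar> * (k\<^sup>2 - 2) + k\<close>, and the quadratic term wins. Such points
  recur with period 2 pi in both directions, so they occur on either side of \<open>k0\<close> for
  either sign of \<open>b\<close>.\<close>

lemma nussbaum_integral_barrier:
  assumes "b \<noteq> 0"
  obtains lo hi where "lo < k0" "k0 < hi"
    "b * nussbaum_integral lo + lo < c" "b * nussbaum_integral hi + hi < c"
proof -
  define s where "s = - sgn b"
  have s: "s = 1 \<or> s = -1" "b * s = - \<bar>b\<bar>" using assms by (auto simp: s_def sgn_if)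
  have sc: "sin (s * pi / 2) = s \<and> cos (s * pi / 2) = 0" using s(1) by auto
  \<comment> \<open>The threshold makes \<open>\<bar>b\<bar> * k\<^sup>2\<close> at least
    \<open>(3 * \<bar>b\<bar> + 1 + \<bar>c\<bar>) * \<bar>k\<bar>\<close>. As
    \<open>\<bar>k\<bar> \<ge> 1\<close>, these terms outweigh \<open>2 * \<bar>b\<bar>\<close>,
    \<open>k\<close> and \<open>\<bar>c\<bar>\<close> in turn; 3 instead of 2 makes the inequality
    strict.\<close>
  have below: "b * nussbaum_integral k + k < c"
    if k: "sin k = s" "cos k = 0" "\<bar>k\<bar> \<ge> 3 + (1 + \<bar>c\<bar>) / \<bar>b\<bar>" for k
  proof -
    have "0 \<le> (1 + \<bar>c\<bar>) / \<bar>b\<bar>" by simp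
    then have k1: "\<bar>k\<bar> \<ge> 1" using k(3) by linarith
    have "\<bar>b\<bar> * k\<^sup>2 = \<bar>b\<bar> * (\<bar>k\<bar> * \<bar>k\<bar>)" by (simp add: power2_eq_square)
    also have "\<dots> \<ge> \<bar>b\<bar> * (\<bar>k\<bar> * (3 + (1 + \<bar>c\<bar>) / \<bar>b\<bar>))"
      using k(3) by (intro mult_left_mono) auto
    also have "\<bar>b\<bar> * (\<bar>k\<bar> * (3 + (1 + \<bar>c\<bar>) / \<bar>b\<bar>)) = 3 * \<bar>b\<bar> * \<bar>k\<bar> + \<bar>k\<bar> + \<bar>c\<bar> * \<bar>k\<bar>"
      using assms by (simp add: field_simps)
    finally have 1: "\<bar>b\<bar> * k\<^sup>2 \<ge> 3 * \<bar>b\<bar> * \<bar>k\<bar> + \<bar>k\<bar> + \<bar>c\<bar> * \<bar>k\<bar>" .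
    have 2: "\<bar>c\<bar> * \<bar>k\<bar> \<ge> \<bar>c\<bar> * 1" "3 * \<bar>b\<bar> * \<bar>k\<bar> \<ge> 3 * \<bar>b\<bar> * 1"
      using k1 by (intro mult_left_mono; simp)+
    have "b * nussbaum_integral k + k = (b * s) * (k\<^sup>2 - 2) + k"
      by (simp add: nussbaum_integral_def k algebra_simps)
    also have "\<dots> = - (\<bar>b\<bar> * k\<^sup>2) + 2 * \<bar>b\<bar> + k" by (simp add: s algebra_simps)
    also have "\<dots> < c" using 1 2 assms abs_ge_self[of k] abs_ge_minus_self[of c] zero_less_abs_iff[of b] by linarith
    finally show ?thesis .
  qed
  \<comment> \<open>The barriers are a quarter turn \<open>q\<close>, with
    \<open>\<bar>q\<bar> < 2\<close>, shifted by \<open>m\<close> full periods to either side. A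
    period exceeds 1, so this \<open>m\<close> clears both the threshold of \<open>below\<close> and
    \<open>k0\<close>.\<close>
  obtain m :: nat where m: "3 + (1 + \<bar>c\<bar>) / \<bar>b\<bar> + \<bar>k0\<bar> + 3 < real m"
    using reals_Archimedean2 by blast
  have r0: "0 \<le> (1 + \<bar>c\<bar>) / \<bar>b\<bar>" by simp
  define q where "q = s * pi / 2"
  have q: "\<bar>q\<bar> < 2" using s(1) pi_less_4 by (auto simp: q_def)
  have "2 * pi * real m \<ge> 1 * real m" using pi_gt3 by (intro mult_right_mono) auto
  then have pm: "2 * pi * real m > 3 + (1 + \<bar>c\<bar>) / \<bar>b\<bar> + \<bar>k0\<bar> + 3" using m by linarith
  have 2: "sin (2 * pi * real m) = 0" "cos (2 * pi * real m) = 1"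
    using sin_2npi[of m] cos_2npi[of m] by (simp_all only: mult_ac)
  have per: "sin (q + 2 * pi * real m) = s" "cos (q + 2 * pi * real m) = 0"
    using sc by (simp_all add: sin_add cos_add q_def 2)
  have per': "sin (q - 2 * pi * real m) = s" "cos (q - 2 * pi * real m) = 0"
    using sc by (simp_all add: sin_diff cos_diff q_def 2)
  show thesis
  proof (rule that)
    show "q - 2 * pi * real m < k0" "k0 < q + 2 * pi * real m" using q pm r0 by linarith+
    show "b * nussbaum_integral (q - 2 * pi * real m) + (q - 2 * pi * real m) < c"
      by (rule below[OF per']) (use q pm r0 in linarith)
    show "b * nussbaum_integral (q + 2 * pi * real m) + (q + 2 * pi * real m) < c"
      by (rule below[OF per]) (use q pm r0 in linarith)
  qed
qed

text \<open>The regressor \<open>\<phi>\<close> and the network coupling \<open>r\<close> enter as arbitrary functions of time.\<close>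

definition agent_loop ::
  "real \<Rightarrow> nat \<Rightarrow> (nat \<Rightarrow> real) \<Rightarrow> real \<Rightarrow> real \<Rightarrow> real set \<Rightarrow> (real \<Rightarrow> real) \<Rightarrow>
   (real \<Rightarrow> nat \<Rightarrow> real) \<Rightarrow> (real \<Rightarrow> real) \<Rightarrow> (real \<Rightarrow> nat \<Rightarrow> real) \<Rightarrow> (real \<Rightarrow> real) \<Rightarrow> bool" where
  "agent_loop b l \<theta> \<nu> \<gamma> S z \<theta>h \<zeta> \<phi> r \<longleftrightarrow>
     (\<forall>t\<in>S.
       (z has_real_derivative
          b * (nussbaum (\<zeta> t) * (dotp l (\<theta>h t) (\<phi> t) + r t + \<nu> * z t)) + dotp l \<theta> (\<phi> t) + r t)
         (at t within S) \<and>
       (\<forall>k<l. ((\<lambda>s. \<theta>h s k) has_real_derivative \<gamma> * \<phi> t k * z t) (at t within S)) \<and>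
       (\<zeta> has_real_derivative \<nu> * (z t)\<^sup>2 + z t * (dotp l (\<theta>h t) (\<phi> t) + r t)) (at t within S))"

text \<open>The bound is uniform in \<open>T\<close>, \<open>\<phi>\<close> and \<open>r\<close>: the energy
  identity \<open>V(t) + \<nu> \<integral>z\<^sup>2 = V(0) + F(\<zeta>(t)) - F(\<zeta>(0))\<close> confines \<open>\<zeta>\<close>
  between two points where \<open>F\<close> lies below \<open>F(\<zeta>(0)) - V(0)\<close>.\<close>

lemma agent_energy_bound:
  fixes b \<nu> \<gamma> z0 \<zeta>0 :: real and \<theta> \<theta>h0 :: "nat \<Rightarrow> real" and l :: nat
  assumes b: "b \<noteq> 0" and \<nu>: "\<nu> > 0" and \<gamma>: "\<gamma> > 0"
  shows "\<exists>C. \<forall>T\<ge>0. \<forall>z \<theta>h \<zeta> \<phi> r. agent_loop b l \<theta> \<nu> \<gamma> {0..T} z \<theta>h \<zeta> \<phi> r \<and>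
      z 0 = z0 \<and> \<zeta> 0 = \<zeta>0 \<and> (\<forall>k<l. \<theta>h 0 k = \<theta>h0 k) \<longrightarrow>
      \<bar>z T\<bar> \<le> C \<and> \<bar>\<zeta> T\<bar> \<le> C \<and> (\<forall>k<l. \<bar>\<theta>h T k\<bar> \<le> C) \<and> integral {0..T} (\<lambda>s. (z s)\<^sup>2) \<le> C"
proof -
  define F where "F k = b * nussbaum_integral k + k" for k
  have derF: "(F has_real_derivative b * nussbaum k + 1) (at k)" for k
    unfolding F_def[abs_def]
    by (auto intro!: derivative_eq_intros DERIV_nussbaum_integral)
  have contF: "continuous_on S F" for S
    using derF by (intro DERIV_continuous_on[of _ _ "\<lambda>k. b * nussbaum k + 1"])
      (auto intro: has_field_derivative_at_within)
  define V0 where "V0 = z0\<^sup>2 / 2 + (\<Sum>k<l. (\<theta>h0 k - \<theta> k)\<^sup>2 / (2 * \<gamma>))"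
  obtain lo hi where lo: "lo < \<zeta>0" "F lo < F \<zeta>0 - V0" and hi: "\<zeta>0 < hi" "F hi < F \<zeta>0 - V0"
    using nussbaum_integral_barrier[OF b, of \<zeta>0 "F \<zeta>0 - V0"] unfolding F_def by metis
  have "bounded (F ` {lo..hi})"
    by (intro compact_imp_bounded compact_continuous_image contF) auto
  then obtain FB where "\<forall>y\<in>F ` {lo..hi}. norm y \<le> FB" unfolding bounded_iff by blast
  then have FB: "\<bar>F k\<bar> \<le> FB" if "k \<in> {lo..hi}" for k using that by simp
  \<comment> \<open>The energy budget: an upper bound for \<open>V + \<nu> * I\<close> as long as
    \<open>\<zeta>\<close> lies between the barriers.\<close>
  define D where "D = max 0 (FB + V0 - F \<zeta>0)"
  have D0: "D \<ge> 0" by (simp add: D_def)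
  define C where "C = \<bar>lo\<bar> + \<bar>hi\<bar> + (1 + 2 * D) + ((\<Sum>k<l. \<bar>\<theta> k\<bar>) + 1 + 2 * \<gamma> * D) + D / \<nu>"
  show ?thesis
  proof (intro exI[of _ C] allI impI)
    fix T :: real and z \<zeta> r :: "real \<Rightarrow> real" and \<theta>h \<phi> :: "real \<Rightarrow> nat \<Rightarrow> real"
    assume T: "T \<ge> 0" and *: "agent_loop b l \<theta> \<nu> \<gamma> {0..T} z \<theta>h \<zeta> \<phi> r \<and>
      z 0 = z0 \<and> \<zeta> 0 = \<zeta>0 \<and> (\<forall>k<l. \<theta>h 0 k = \<theta>h0 k)"
    have init: "z 0 = z0" "\<zeta> 0 = \<zeta>0" "\<And>k. k < l \<Longrightarrow> \<theta>h 0 k = \<theta>h0 k" using * by auto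
    have dz: "(z has_real_derivative
         b * (nussbaum (\<zeta> t) * (dotp l (\<theta>h t) (\<phi> t) + r t + \<nu> * z t)) + dotp l \<theta> (\<phi> t) + r t)
         (at t within {0..T})"
      and d\<theta>h: "k < l \<Longrightarrow>
         ((\<lambda>s. \<theta>h s k) has_real_derivative \<gamma> * \<phi> t k * z t) (at t within {0..T})"
      and d\<zeta>: "(\<zeta> has_real_derivative
         \<nu> * (z t)\<^sup>2 + z t * (dotp l (\<theta>h t) (\<phi> t) + r t)) (at t within {0..T})"
      if "t \<in> {0..T}" for t k
      using * that unfolding agent_loop_def by blast+
    define V where "V t = (z t)\<^sup>2 / 2 + (\<Sum>k<l. (\<theta>h t k - \<theta> k)\<^sup>2 / (2 * \<gamma>))" for t
    define I where "I t = integral {0..t} (\<lambda>s. (z s)\<^sup>2)" for t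
    have cz: "continuous_on {0..T} z" using dz by (rule DERIV_continuous_on)
    have c\<zeta>: "continuous_on {0..T} \<zeta>" using d\<zeta> by (rule DERIV_continuous_on)
    have dI: "(I has_real_derivative (z t)\<^sup>2) (at t within {0..T})" if "t \<in> {0..T}" for t
      unfolding I_def[abs_def]
      by (rule integral_has_real_derivative[OF _ that]) (intro continuous_intros cz)
    have I0: "I t \<ge> 0" if "t \<in> {0..T}" for t
      unfolding I_def using that
      by (intro integral_nonneg integrable_continuous_real continuous_intros continuous_on_subset[OF cz]) auto
    have dF: "((\<lambda>t. F (\<zeta> t)) has_real_derivative
        (b * nussbaum (\<zeta> t) + 1) * (\<nu> * (z t)\<^sup>2 + z t * (dotp l (\<theta>h t) (\<phi> t) + r t)))
        (at t within {0..T})" if "t \<in> {0..T}" for t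
      by (rule DERIV_chain2[OF derF d\<zeta>[OF that]])
    have dV: "(V has_real_derivative
        z t * (b * (nussbaum (\<zeta> t) * (dotp l (\<theta>h t) (\<phi> t) + r t + \<nu> * z t)) + dotp l \<theta> (\<phi> t) + r t)
        + z t * (dotp l (\<theta>h t) (\<phi> t) - dotp l \<theta> (\<phi> t))) (at t within {0..T})"
      if t: "t \<in> {0..T}" for t
    proof -
      have "((\<lambda>s. (z s)\<^sup>2 / 2) has_real_derivative z t * (b * (nussbaum (\<zeta> t) *
          (dotp l (\<theta>h t) (\<phi> t) + r t + \<nu> * z t)) + dotp l \<theta> (\<phi> t) + r t)) (at t within {0..T})"
        by (auto intro!: derivative_eq_intros dz[OF t])
      moreover have "((\<lambda>s. \<Sum>k<l. (\<theta>h s k - \<theta> k)\<^sup>2 / (2 * \<gamma>)) has_real_derivative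
          (\<Sum>k<l. z t * (\<theta>h t k * \<phi> t k - \<theta> k * \<phi> t k))) (at t within {0..T})"
      proof (rule DERIV_sum)
        fix k assume "k \<in> {..<l}"
        then have "((\<lambda>s. \<theta>h s k) has_real_derivative \<gamma> * \<phi> t k * z t) (at t within {0..T})"
          using d\<theta>h[OF t] by simp
        from this show "((\<lambda>s. (\<theta>h s k - \<theta> k)\<^sup>2 / (2 * \<gamma>)) has_real_derivative
            z t * (\<theta>h t k * \<phi> t k - \<theta> k * \<phi> t k)) (at t within {0..T})"
          using \<gamma> by (auto intro!: derivative_eq_intros simp: field_simps)
      qed
      moreover have "(\<Sum>k<l. z t * (\<theta>h t k * \<phi> t k - \<theta> k * \<phi> t k))
          = z t * (dotp l (\<theta>h t) (\<phi> t) - dotp l \<theta> (\<phi> t))"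
        by (simp add: dotp_def sum_subtractf sum_distrib_left right_diff_distrib)
      ultimately show ?thesis unfolding V_def[abs_def] by (auto intro: DERIV_add)
    qed
    \<comment> \<open>The adaptation law turns \<open>\<theta>\<close> into \<open>\<theta>h\<close>
      in the derivative of \<open>V\<close>, which becomes
      \<open>(b * nussbaum \<zeta> + 1) * \<zeta>' - \<nu> * z\<^sup>2\<close>. The Nussbaum factor
      stems from the input, the 1 from the terms that reach \<open>z\<close> without passing through
      the gain; this is the origin of the summand \<open>k\<close> in \<open>F\<close>.\<close>
    have "((\<lambda>t. V t + \<nu> * I t - F (\<zeta> t)) has_real_derivative 0) (at t within {0..T})"
      if t: "t \<in> {0..T}" for t
    proof -
      have "((\<lambda>t. V t + \<nu> * I t - F (\<zeta> t)) has_real_derivative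
        (z t * (b * (nussbaum (\<zeta> t) * (dotp l (\<theta>h t) (\<phi> t) + r t + \<nu> * z t)) + dotp l \<theta> (\<phi> t) + r t)
        + z t * (dotp l (\<theta>h t) (\<phi> t) - dotp l \<theta> (\<phi> t))) + \<nu> * (z t)\<^sup>2
        - (b * nussbaum (\<zeta> t) + 1) * (\<nu> * (z t)\<^sup>2 + z t * (dotp l (\<theta>h t) (\<phi> t) + r t)))
        (at t within {0..T})"
        by (intro DERIV_diff DERIV_add DERIV_cmult dV dI dF t)
      then show ?thesis by (simp add: algebra_simps power2_eq_square)
    qed
    then obtain c where c: "\<And>t. t \<in> {0..T} \<Longrightarrow> V t + \<nu> * I t - F (\<zeta> t) = c"
      using has_field_derivative_zero_constant[of "{0..T}" "\<lambda>t. V t + \<nu> * I t - F (\<zeta> t)"] by auto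
    have "V 0 = V0" using init by (simp add: V_def V0_def)
    then have energy: "V t + \<nu> * I t = V0 + F (\<zeta> t) - F \<zeta>0" if "t \<in> {0..T}" for t
      using c[OF that] c[of 0] T init by (simp add: I_def)
    have V_nonneg: "V t \<ge> 0" for t using \<gamma> by (auto simp: V_def intro!: add_nonneg_nonneg sum_nonneg)
    have above: "F (\<zeta> t) \<ge> F \<zeta>0 - V0" if "t \<in> {0..T}" for t
      using energy[OF that] V_nonneg[of t] mult_nonneg_nonneg[of \<nu> "I t"] I0[OF that] \<nu> by linarith
    have "\<zeta> T < hi"
    proof (rule ccontr)
      assume "\<not> \<zeta> T < hi"
      then obtain t where "0 \<le> t" "t \<le> T" "\<zeta> t = hi"
        using IVT'[of \<zeta> 0 hi T] T c\<zeta> init hi by auto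
      then show False using above[of t] hi by simp
    qed
    moreover have "lo < \<zeta> T"
    proof (rule ccontr)
      assume "\<not> lo < \<zeta> T"
      then obtain t where "0 \<le> t" "t \<le> T" "\<zeta> t = lo"
        using IVT2'[of \<zeta> T lo 0] T c\<zeta> init lo by auto
      then show False using above[of t] lo by simp
    qed
    ultimately have \<zeta>T: "\<zeta> T \<in> {lo..hi}" by simp
    have TT: "T \<in> {0..T}" using T by simp
    have E: "V T + \<nu> * I T \<le> D" using energy[OF TT] FB[OF \<zeta>T] by (simp add: D_def)
    have \<nu>I: "\<nu> * I T \<ge> 0" using I0[OF TT] \<nu> by simp
    have VD: "V T \<le> D" using E \<nu>I by simp
    have sum0: "(\<Sum>k<l. (\<theta>h T k - \<theta> k)\<^sup>2 / (2 * \<gamma>)) \<ge> 0" using \<gamma> by (auto intro!: sum_nonneg)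
    \<comment> \<open>Turns bounds on squares into bounds on absolute values without extracting
      roots.\<close>
    have abs_le: "\<bar>a\<bar> \<le> 1 + a\<^sup>2" for a :: real
    proof -
      have "0 \<le> (\<bar>a\<bar> - 1)\<^sup>2 + a\<^sup>2 + 1" by simp
      then show ?thesis by (simp add: power2_diff)
    qed
    have th0: "0 \<le> (\<Sum>k<l. \<bar>\<theta> k\<bar>)" by (simp add: sum_nonneg)
    have nn: "0 \<le> 2 * \<gamma> * D" "0 \<le> D / \<nu>" using \<gamma> \<nu> D0 by auto
    have "(z T)\<^sup>2 \<le> 2 * D" using VD sum0 by (simp add: V_def)
    then have 1: "\<bar>z T\<bar> \<le> 1 + 2 * D" using abs_le[of "z T"] by linarith
    have 2: "\<bar>\<zeta> T\<bar> \<le> \<bar>lo\<bar> + \<bar>hi\<bar>" using \<zeta>T by auto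
    have 3: "\<bar>\<theta>h T k\<bar> \<le> (\<Sum>k<l. \<bar>\<theta> k\<bar>) + 1 + 2 * \<gamma> * D" if "k < l" for k
    proof -
      have "(\<theta>h T k - \<theta> k)\<^sup>2 / (2 * \<gamma>) \<le> (\<Sum>k<l. (\<theta>h T k - \<theta> k)\<^sup>2 / (2 * \<gamma>))"
        using that \<gamma> by (intro member_le_sum) auto
      also have "\<dots> \<le> D" using VD zero_le_power2[of "z T"] unfolding V_def by linarith
      finally have "(\<theta>h T k - \<theta> k)\<^sup>2 \<le> 2 * \<gamma> * D" using \<gamma> by (simp add: field_simps)
      moreover have "\<bar>\<theta> k\<bar> \<le> (\<Sum>k<l. \<bar>\<theta> k\<bar>)" using that by (intro member_le_sum) auto
      ultimately show ?thesis using abs_le[of "\<theta>h T k - \<theta> k"] by linarith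
    qed
    have 4: "I T \<le> D / \<nu>" using E V_nonneg[of T] \<nu> by (simp add: field_simps)
    show "\<bar>z T\<bar> \<le> C \<and> \<bar>\<zeta> T\<bar> \<le> C \<and> (\<forall>k<l. \<bar>\<theta>h T k\<bar> \<le> C) \<and> integral {0..T} (\<lambda>s. (z s)\<^sup>2) \<le> C"
    proof (intro conjI allI impI)
      show "\<bar>z T\<bar> \<le> C" "\<bar>\<zeta> T\<bar> \<le> C" "integral {0..T} (\<lambda>s. (z s)\<^sup>2) \<le> C"
        using 1 2 4 D0 nn th0 unfolding C_def I_def by linarith+
      show "\<bar>\<theta>h T k\<bar> \<le> C" if "k < l" for k
        using 3[OF that] D0 nn unfolding C_def by linarith
    qed
  qed
qed

section \<open>The consensus network\<close>

text \<open>The left null vectors of the Laplacian, read column by column: the flows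
  \<open>q i * A $ i $ j\<close> form a circulation. Self-loops contribute equally to both sides.
  Functions in place of vectors allow expressions such as \<open>\<bar>\<omega> i\<bar>\<close> to
  be inserted directly.\<close>

definition balanced :: "real^'n^'n \<Rightarrow> ('n \<Rightarrow> real) \<Rightarrow> bool" where
  "balanced A q \<longleftrightarrow> (\<forall>j. q j * in_degree A j = (\<Sum>i\<in>UNIV. q i * A $ i $ j))"

lemma left_null_vector_balanced:
  fixes A :: "real^'n^'n"
  assumes "\<omega> v* laplacian A = 0"
  shows "balanced A (\<lambda>i. \<omega> $ i)"
  unfolding balanced_def
proof
  fix j
  have "0 = (\<omega> v* laplacian A) $ j" using assms by simp
  also have "\<dots> = (\<Sum>i\<in>UNIV. ((if i = j then in_degree A i else 0) - A $ i $ j) * \<omega> $ i)"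
    by (simp add: vector_matrix_mult_def laplacian_def mult.commute)
  also have "\<dots> = \<omega> $ j * in_degree A j - (\<Sum>i\<in>UNIV. \<omega> $ i * A $ i $ j)"
  proof -
    have "((if i = j then in_degree A i else 0) - A $ i $ j) * \<omega> $ i
        = (if i = j then \<omega> $ j * in_degree A j else 0) - \<omega> $ i * A $ i $ j" for i
      by (simp add: algebra_simps)
    then show ?thesis by (simp add: sum_subtractf)
  qed
  finally show "\<omega> $ j * in_degree A j = (\<Sum>i\<in>UNIV. \<omega> $ i * A $ i $ j)" by simp
qed

section \<open>Positivity of the left null vector\<close>

lemma adjacency_matrix_nonneg:
  assumes "adjacency_matrix E A"
  shows "A $ i $ j \<ge> 0"
  using assms unfolding adjacency_matrix_def by (metis less_imp_le order_refl)

text \<open>If \<open>q k = 0\<close>, column \<open>k\<close> of the balance is a vanishing sum of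
  nonnegative terms, so \<open>q\<close> also vanishes at the head of every edge that leaves
  \<open>k\<close>. Strong connectivity spreads one zero to all nodes.\<close>

lemma nonneg_balanced_zero_or_pos:
  fixes A :: "real^'n^'n"
  assumes adj: "adjacency_matrix E A" and conn: "strongly_connected E"
    and q: "\<And>i. q i \<ge> 0" "balanced A q"
  shows "(\<forall>i. q i = 0) \<or> (\<forall>i. q i > 0)"
proof (cases "\<exists>j. q j = 0")
  case True
  then obtain j where j: "q j = 0" by blast
  have step: "q i = 0" if "q k = 0" "(k, i) \<in> E" for k i
  proof -
    have "(\<Sum>i\<in>UNIV. q i * A $ i $ k) = 0"
      using q(2) that(1) unfolding balanced_def by (metis mult_zero_left)
    then have "q i * A $ i $ k = 0"
      using q(1) adjacency_matrix_nonneg[OF adj] by (simp add: sum_nonneg_eq_0_iff)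
    moreover have "A $ i $ k > 0" using adj that(2) unfolding adjacency_matrix_def by blast
    ultimately show ?thesis by simp
  qed
  have "q i = 0" if "(j, i) \<in> E\<^sup>+" for i
    using that by (induction rule: trancl_induct) (use j step in auto)
  then show ?thesis using conn j unfolding strongly_connected_def by metis
qed (use q(1) in \<open>auto simp: less_le\<close>)

text \<open>Perron--Frobenius for the Laplacian: \<open>\<bar>\<omega>\<bar>\<close> is again a left null vector, because the
  triangle inequality in each column becomes an equality after summing over the columns.\<close>

lemma left_null_vector_pos:
  fixes A :: "real^'n^'n"
  assumes adj: "adjacency_matrix E A" and conn: "strongly_connected E"
    and \<omega>: "balanced A \<omega>" and one: "(\<Sum>k\<in>UNIV. \<omega> k) = 1"
  shows "\<omega> i > 0"
proof -
  note A = adjacency_matrix_nonneg[OF adj]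
  have d: "in_degree A j \<ge> 0" for j unfolding in_degree_def using A by (simp add: sum_nonneg)
  have le: "0 \<le> (\<Sum>i\<in>UNIV. \<bar>\<omega> i\<bar> * A $ i $ j) - \<bar>\<omega> j\<bar> * in_degree A j" for j
  proof -
    have "\<bar>\<omega> j\<bar> * in_degree A j = \<bar>\<Sum>i\<in>UNIV. \<omega> i * A $ i $ j\<bar>"
      using \<omega> d[of j] unfolding balanced_def by (metis abs_mult abs_of_nonneg)
    also have "\<dots> \<le> (\<Sum>i\<in>UNIV. \<bar>\<omega> i * A $ i $ j\<bar>)" by (rule sum_abs)
    also have "\<dots> = (\<Sum>i\<in>UNIV. \<bar>\<omega> i\<bar> * A $ i $ j)" using A by (simp add: abs_mult)
    finally show ?thesis by simp
  qed
  have "(\<Sum>j\<in>UNIV. (\<Sum>i\<in>UNIV. \<bar>\<omega> i\<bar> * A $ i $ j) - \<bar>\<omega> j\<bar> * in_degree A j)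
      = (\<Sum>j\<in>UNIV. \<Sum>i\<in>UNIV. \<bar>\<omega> i\<bar> * A $ i $ j) - (\<Sum>j\<in>UNIV. \<Sum>i\<in>UNIV. \<bar>\<omega> j\<bar> * A $ j $ i)"
    by (simp add: sum_subtractf in_degree_def sum_distrib_left)
  also have "\<dots> = 0" by (subst sum.swap) simp
  finally have "balanced A (\<lambda>i. \<bar>\<omega> i\<bar>)"
    using le by (simp add: balanced_def sum_nonneg_eq_0_iff)
  \<comment> \<open>This is twice the negative part of \<open>\<omega>\<close>, which therefore
    vanishes everywhere or nowhere. In the second case all weights would be negative, against their
    sum 1.\<close>
  then have "balanced A (\<lambda>i. \<bar>\<omega> i\<bar> - \<omega> i)"
    using \<omega> unfolding balanced_def by (simp add: left_diff_distrib sum_subtractf)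
  then have "(\<forall>i. \<bar>\<omega> i\<bar> - \<omega> i = 0) \<or> (\<forall>i. \<bar>\<omega> i\<bar> - \<omega> i > 0)"
    by (intro nonneg_balanced_zero_or_pos[OF adj conn]) auto
  moreover have False if "\<forall>i. \<bar>\<omega> i\<bar> - \<omega> i > 0"
  proof -
    have "\<omega> i < 0" for i using that[rule_format, of i] by linarith
    then have "(\<Sum>k\<in>UNIV. \<omega> k) \<le> 0" by (simp add: sum_nonpos less_imp_le)
    then show False using one by simp
  qed
  ultimately have "\<omega> i \<ge> 0" for i by (metis abs_ge_zero eq_iff_diff_eq_0)
  then have "(\<forall>i. \<omega> i = 0) \<or> (\<forall>i. \<omega> i > 0)"
    using \<omega> by (intro nonneg_balanced_zero_or_pos[OF adj conn])
  then show ?thesis using one by auto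
qed

section \<open>Dirichlet form and energy of the driven protocol\<close>

text \<open>Both halves of the difference equal the sum of
  \<open>\<omega> j * in_degree A j * y j\<close>. With \<open>y = p + z\<close> this conserves the
  weighted mean; with \<open>y = p\<^sup>2 / 2\<close> it symmetrizes the quadratic form.\<close>

lemma balanced_sum_diff_eq_0:
  fixes A :: "real^'n^'n"
  assumes "balanced A \<omega>"
  shows "(\<Sum>i\<in>UNIV. \<Sum>j\<in>UNIV. \<omega> i * A $ i $ j * (y i - y j)) = 0"
proof -
  have "(\<Sum>i\<in>UNIV. \<Sum>j\<in>UNIV. \<omega> i * A $ i $ j * (y i - y j))
      = (\<Sum>i\<in>UNIV. \<Sum>j\<in>UNIV. \<omega> i * A $ i $ j * y i)
        - (\<Sum>i\<in>UNIV. \<Sum>j\<in>UNIV. \<omega> i * A $ i $ j * y j)"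
    by (simp add: right_diff_distrib sum_subtractf)
  also have "(\<Sum>i\<in>UNIV. \<Sum>j\<in>UNIV. \<omega> i * A $ i $ j * y j)
      = (\<Sum>j\<in>UNIV. (\<Sum>i\<in>UNIV. \<omega> i * A $ i $ j) * y j)"
    by (subst sum.swap) (simp add: sum_distrib_right)
  also have "\<dots> = (\<Sum>j\<in>UNIV. \<omega> j * in_degree A j * y j)"
    using assms by (simp add: balanced_def)
  also have "(\<Sum>i\<in>UNIV. \<Sum>j\<in>UNIV. \<omega> i * A $ i $ j * y i)
      = (\<Sum>j\<in>UNIV. \<omega> j * in_degree A j * y j)"
    by (simp add: in_degree_def sum_distrib_left sum_distrib_right)
  finally show ?thesis by simp
qed

text \<open>Split \<open>p i * (p i - p j)\<close> into half the square of the difference plus half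
  the difference of the squares; the latter cancels by balance. So the weighted form is a sum of
  squares although the Laplacian is not symmetric.\<close>

lemma balanced_dirichlet_form:
  fixes A :: "real^'n^'n"
  assumes "balanced A \<omega>"
  shows "(\<Sum>i\<in>UNIV. \<omega> i * p i * (\<Sum>j\<in>UNIV. A $ i $ j * (p i - p j)))
    = (\<Sum>i\<in>UNIV. \<Sum>j\<in>UNIV. \<omega> i * A $ i $ j * (p i - p j)\<^sup>2) / 2"
proof -
  have "(\<Sum>i\<in>UNIV. \<omega> i * p i * (\<Sum>j\<in>UNIV. A $ i $ j * (p i - p j)))
      = (\<Sum>i\<in>UNIV. \<Sum>j\<in>UNIV. (\<omega> i * A $ i $ j * (p i - p j)\<^sup>2) / 2
          + \<omega> i * A $ i $ j * ((p i)\<^sup>2 / 2 - (p j)\<^sup>2 / 2))"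
    unfolding sum_distrib_left
    by (intro sum.cong refl) (simp add: field_simps power2_eq_square)
  also have "\<dots> = (\<Sum>i\<in>UNIV. \<Sum>j\<in>UNIV. \<omega> i * A $ i $ j * (p i - p j)\<^sup>2) / 2"
    using balanced_sum_diff_eq_0[OF assms, of "\<lambda>i. (p i)\<^sup>2 / 2"]
    by (simp add: sum.distrib sum_divide_distrib)
  finally show ?thesis .
qed

text \<open>On a strongly connected graph the form vanishes only at constants, and with positive
  weights a constant of zero mean is 0. Compactness of the unit sphere in the zero-mean hyperplane
  gives a positive minimum, and homogeneity extends it to all \<open>p\<close>.\<close>

lemma dirichlet_form_poincare:
  fixes A :: "real^'n^'n"
  assumes adj: "adjacency_matrix E A" and conn: "strongly_connected E"
    and \<omega>: "\<And>i. \<omega> i > 0"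
  obtains \<alpha> where "\<alpha> > 0" "\<And>p. (\<Sum>i\<in>UNIV. \<omega> i * p i) = 0 \<Longrightarrow>
    \<alpha> * (\<Sum>i\<in>UNIV. (p i)\<^sup>2) \<le> (\<Sum>i\<in>UNIV. \<Sum>j\<in>UNIV. \<omega> i * A $ i $ j * (p i - p j)\<^sup>2)"
proof -
  note A = adjacency_matrix_nonneg[OF adj]
  define Q :: "real^'n \<Rightarrow> real" where
    "Q p = (\<Sum>i\<in>UNIV. \<Sum>j\<in>UNIV. \<omega> i * A $ i $ j * (p $ i - p $ j)\<^sup>2)" for p
  have term_nonneg: "\<omega> i * A $ i $ j * (p $ i - p $ j)\<^sup>2 \<ge> 0" for p :: "real^'n" and i j
    using A[of i j] \<omega>[of i] by simp
  have Q0: "Q p \<ge> 0" for p unfolding Q_def by (intro sum_nonneg term_nonneg)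
  define S where "S = {p :: real^'n. norm p = 1 \<and> (\<Sum>i\<in>UNIV. \<omega> i * p $ i) = 0}"
  have S: "S = sphere 0 1 \<inter> {p. (\<Sum>i\<in>UNIV. \<omega> i * p $ i) = 0}" by (auto simp: S_def)
  have "compact S"
    unfolding S by (intro compact_Int_closed compact_sphere closed_Collect_eq continuous_intros)
  have pos: "Q p > 0" if p: "p \<in> S" for p
  proof (rule ccontr)
    assume "\<not> Q p > 0"
    then have "Q p = 0" using Q0[of p] by simp
    then have z: "\<omega> i * A $ i $ j * (p $ i - p $ j)\<^sup>2 = 0" for i j
      unfolding Q_def using term_nonneg by (auto simp add: sum_nonneg_eq_0_iff sum_nonneg)
    have edge: "p $ i = p $ j" if "(j, i) \<in> E" for i j
    proof -
      have "A $ i $ j > 0" using adj that unfolding adjacency_matrix_def by blast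
      then show ?thesis using z[of i j] \<omega>[of i] by simp
    qed
    have path: "p $ i = p $ j" if "(j, i) \<in> E\<^sup>+" for i j
      using that by (induction rule: trancl_induct) (use edge in auto)
    obtain k :: 'n where True by simp
    have const: "p $ i = p $ k" for i
      using conn path unfolding strongly_connected_def by metis
    have "(\<Sum>i\<in>UNIV. \<omega> i) * p $ k = (\<Sum>i\<in>UNIV. \<omega> i * p $ i)"
      unfolding sum_distrib_right by (intro sum.cong refl) (simp add: const[symmetric])
    also have "\<dots> = 0" using p by (simp add: S_def)
    finally have "p $ k = 0" using sum_pos[of UNIV \<omega>] \<omega> by simp
    then have "p = 0" using const by (simp add: vec_eq_iff)
    then show False using p by (simp add: S_def)
  qed
  have "continuous_on S Q" unfolding Q_def[abs_def] by (intro continuous_intros)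
  \<comment> \<open>For a single node the hyperplane is just 0, so \<open>S\<close> is empty and any
    positive constant will do.\<close>
  have "\<exists>\<alpha>>0. \<forall>p\<in>S. \<alpha> \<le> Q p"
  proof (cases "S = {}")
    case False
    then obtain m where "m \<in> S" "\<forall>p\<in>S. Q m \<le> Q p"
      using continuous_attains_inf[OF \<open>compact S\<close> _ \<open>continuous_on S Q\<close>] by blast
    then show ?thesis using pos by blast
  qed (auto intro: exI[of _ 1])
  then obtain \<alpha> where \<alpha>: "\<alpha> > 0" "\<And>p. p \<in> S \<Longrightarrow> \<alpha> \<le> Q p" by blast
  show thesis
  proof (rule that[OF \<alpha>(1)])
    fix p assume p: "(\<Sum>i\<in>UNIV. \<omega> i * p i) = 0"
    define v :: "real^'n" where "v = (\<chi> i. p i)"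
    have nv: "(norm v)\<^sup>2 = (\<Sum>i\<in>UNIV. (p i)\<^sup>2)"
      by (simp add: v_def norm_vec_def L2_set_def sum_nonneg)
    have "\<alpha> * (norm v)\<^sup>2 \<le> Q v"
    proof (cases "v = 0")
      case False
      then have n: "norm v > 0" by simp
      have "(\<Sum>i\<in>UNIV. \<omega> i * (v /\<^sub>R norm v) $ i) = (\<Sum>i\<in>UNIV. \<omega> i * p i) / norm v"
        by (simp add: v_def sum_divide_distrib field_simps)
      then have "v /\<^sub>R norm v \<in> S" using False p by (simp add: S_def)
      from \<alpha>(2)[OF this] have "\<alpha> \<le> Q (v /\<^sub>R norm v)" .
      also have "\<dots> = Q v / (norm v)\<^sup>2"
        unfolding Q_def sum_divide_distrib
        by (intro sum.cong refl) (simp add: power_divide divide_inverse power_mult_distrib power_inverse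
            flip: right_diff_distrib)
      finally show ?thesis using n by (simp add: field_simps)
    qed (use Q0 in simp)
    then show "\<alpha> * (\<Sum>i\<in>UNIV. (p i)\<^sup>2) \<le> (\<Sum>i\<in>UNIV. \<Sum>j\<in>UNIV. \<omega> i * A $ i $ j * (p i - p j)\<^sup>2)"
      by (simp add: nv) (simp add: Q_def v_def)
  qed
qed

lemma network_dissipation:
  fixes A :: "real^'n^'n"
  assumes adj: "adjacency_matrix E A" and conn: "strongly_connected E"
    and \<omega>: "balanced A \<omega>" "\<And>i. \<omega> i > 0" and \<rho>: "\<rho> > 0"
  obtains \<alpha> \<beta> where "\<alpha> > 0" "\<beta> \<ge> 0" "\<And>p z. (\<Sum>i\<in>UNIV. \<omega> i * p i) = 0 \<Longrightarrow>
    (\<Sum>i\<in>UNIV. \<omega> i * p i * (- \<rho> * (\<Sum>j\<in>UNIV. A $ i $ j * ((p i + z i) - (p j + z j)))))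
      \<le> - \<alpha> * (\<Sum>i\<in>UNIV. (p i)\<^sup>2) + \<beta> * (\<Sum>i\<in>UNIV. (z i)\<^sup>2)"
proof -
  obtain a where a: "a > 0" "\<And>p. (\<Sum>i\<in>UNIV. \<omega> i * p i) = 0 \<Longrightarrow>
      a * (\<Sum>i\<in>UNIV. (p i)\<^sup>2) \<le> (\<Sum>i\<in>UNIV. \<Sum>j\<in>UNIV. \<omega> i * A $ i $ j * (p i - p j)\<^sup>2)"
    by (rule dirichlet_form_poincare[where \<omega> = \<omega>, OF adj conn \<omega>(2)]) (rule that, assumption, blast)
  \<comment> \<open>The weighted Laplacian as a linear map; its boundedness supplies the constant
    \<open>B\<close> for the cross term between \<open>p\<close> and \<open>z\<close>.\<close>
  define f :: "real^'n \<Rightarrow> real^'n" where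
    "f z = (\<chi> i. \<omega> i * (\<Sum>j\<in>UNIV. A $ i $ j * (z $ i - z $ j)))" for z
  have "linear f"
  proof (rule linearI)
    show "f (x + y) = f x + f y" for x y
      by (simp add: f_def vec_eq_iff algebra_simps sum.distrib sum_subtractf)
    show "f (c *\<^sub>R x) = c *\<^sub>R f x" for c x
      by (simp add: f_def vec_eq_iff sum_distrib_left) (intro sum.cong refl allI, simp add: algebra_simps)
  qed
  then obtain B where B: "B > 0" "\<And>z. norm (f z) \<le> B * norm z"
    using linear_bounded_pos by blast
  show thesis
  \<comment> \<open>The Dirichlet form supplies the coefficient \<open>\<rho> * a / 2\<close>. Half
    of it absorbs the cross term by completing the square of
    \<open>a * norm u / 2 - B * norm v\<close>, at the cost \<open>\<rho> * B\<^sup>2 / a\<close> on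
    the side of \<open>z\<close>.\<close>
  proof (rule that[of "\<rho> * a / 4" "\<rho> * B\<^sup>2 / a"])
    show "\<rho> * a / 4 > 0" "\<rho> * B\<^sup>2 / a \<ge> 0" using \<rho> a by auto
    fix p z assume p: "(\<Sum>i\<in>UNIV. \<omega> i * p i) = 0"
    define u v :: "real^'n" where "u = (\<chi> i. p i)" and "v = (\<chi> i. z i)"
    have nu: "(\<Sum>i\<in>UNIV. (p i)\<^sup>2) = (norm u)\<^sup>2" and nv: "(\<Sum>i\<in>UNIV. (z i)\<^sup>2) = (norm v)\<^sup>2"
      by (simp_all add: u_def v_def norm_vec_def L2_set_def sum_nonneg)
    have "(\<Sum>i\<in>UNIV. \<omega> i * p i * (- \<rho> * (\<Sum>j\<in>UNIV. A $ i $ j * ((p i + z i) - (p j + z j)))))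
        = - \<rho> * (\<Sum>i\<in>UNIV. \<omega> i * p i * (\<Sum>j\<in>UNIV. A $ i $ j * (p i - p j)))
          - \<rho> * (\<Sum>i\<in>UNIV. p i * (\<omega> i * (\<Sum>j\<in>UNIV. A $ i $ j * (z i - z j))))"
    proof -
      have "(\<Sum>j\<in>UNIV. A $ i $ j * ((p i + z i) - (p j + z j)))
          = (\<Sum>j\<in>UNIV. A $ i $ j * (p i - p j)) + (\<Sum>j\<in>UNIV. A $ i $ j * (z i - z j))" for i
        by (simp add: algebra_simps flip: sum.distrib)
      moreover have "(\<Sum>i\<in>UNIV. \<omega> i * p i * (- \<rho> * (X i + Y i)))
          = - \<rho> * (\<Sum>i\<in>UNIV. \<omega> i * p i * X i) - \<rho> * (\<Sum>i\<in>UNIV. p i * (\<omega> i * Y i))" for X Y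
        unfolding sum_distrib_left sum_subtractf[symmetric]
        by (intro sum.cong refl) (simp add: algebra_simps)
      ultimately show ?thesis by simp
    qed
    also have "(\<Sum>i\<in>UNIV. p i * (\<omega> i * (\<Sum>j\<in>UNIV. A $ i $ j * (z i - z j)))) = u \<bullet> f v"
      by (simp add: inner_vec_def u_def v_def f_def)
    also have "(\<Sum>i\<in>UNIV. \<omega> i * p i * (\<Sum>j\<in>UNIV. A $ i $ j * (p i - p j)))
        = (\<Sum>i\<in>UNIV. \<Sum>j\<in>UNIV. \<omega> i * A $ i $ j * (p i - p j)\<^sup>2) / 2"
      by (rule balanced_dirichlet_form[OF \<omega>(1)])
    also have "- \<rho> * ((\<Sum>i\<in>UNIV. \<Sum>j\<in>UNIV. \<omega> i * A $ i $ j * (p i - p j)\<^sup>2) / 2) - \<rho> * (u \<bullet> f v)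
        \<le> - \<rho> * (a * (norm u)\<^sup>2 / 2) + \<rho> * (norm u * (B * norm v))"
    proof -
      have "\<rho> * (a * (norm u)\<^sup>2) \<le> \<rho> * (\<Sum>i\<in>UNIV. \<Sum>j\<in>UNIV. \<omega> i * A $ i $ j * (p i - p j)\<^sup>2)"
        using a(2)[OF p] \<rho> by (intro mult_left_mono) (auto simp: nu)
      moreover have "\<bar>u \<bullet> f v\<bar> \<le> norm u * (B * norm v)"
        using Cauchy_Schwarz_ineq2[of u "f v"] mult_left_mono[OF B(2)[of v], of "norm u"] by simp
      then have "- (u \<bullet> f v) \<le> norm u * (B * norm v)" by linarith
      then have "\<rho> * (- (u \<bullet> f v)) \<le> \<rho> * (norm u * (B * norm v))"
        using \<rho> by (intro mult_left_mono) auto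
      ultimately show ?thesis by simp
    qed
    also have "\<dots> = - (\<rho> * a / 4) * (norm u)\<^sup>2 + \<rho> * B\<^sup>2 / a * (norm v)\<^sup>2
        - \<rho> / a * (a * norm u / 2 - B * norm v)\<^sup>2"
      using a by (simp add: field_simps power2_eq_square)
    also have "\<dots> \<le> - (\<rho> * a / 4) * (norm u)\<^sup>2 + \<rho> * B\<^sup>2 / a * (norm v)\<^sup>2"
      using a \<rho> by simp
    finally show "(\<Sum>i\<in>UNIV. \<omega> i * p i * (- \<rho> * (\<Sum>j\<in>UNIV. A $ i $ j * ((p i + z i) - (p j + z j)))))
        \<le> - (\<rho> * a / 4) * (\<Sum>i\<in>UNIV. (p i)\<^sup>2) + \<rho> * B\<^sup>2 / a * (\<Sum>i\<in>UNIV. (z i)\<^sup>2)"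
      by (simp add: nu nv)
  qed
qed

text \<open>Integrating the dissipation inequality bounds the weighted energy and the integral of
  \<open>p\<^sup>2\<close> at once. The constant \<open>C\<close> is fixed before \<open>T\<close>,
  \<open>p\<close> and \<open>z\<close>, and knows \<open>z\<close> only through \<open>M\<close>;
  the global existence argument relies on this uniformity.\<close>

lemma network_energy_bound:
  fixes A :: "real^'n^'n"
  assumes adj: "adjacency_matrix E A" and conn: "strongly_connected E"
    and \<omega>: "balanced A \<omega>" "\<And>i. \<omega> i > 0" and \<rho>: "\<rho> > 0" and p0: "(\<Sum>i\<in>UNIV. \<omega> i * p0 i) = 0"
  obtains C where "\<And>T p z. T \<ge> 0 \<Longrightarrow> (\<And>i. p i 0 = p0 i) \<Longrightarrow>
      (\<And>i. continuous_on {0..T} (z i)) \<Longrightarrow>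
      (\<And>i. integral {0..T} (\<lambda>s. (z i s)\<^sup>2) \<le> M) \<Longrightarrow>
      (\<And>i t. t \<in> {0..T} \<Longrightarrow> (p i has_real_derivative
         - \<rho> * (\<Sum>j\<in>UNIV. A $ i $ j * ((p i t + z i t) - (p j t + z j t)))) (at t within {0..T})) \<Longrightarrow>
      (\<forall>i. \<bar>p i T\<bar> \<le> C \<and> integral {0..T} (\<lambda>s. (p i s)\<^sup>2) \<le> C)"
proof -
  obtain \<alpha> \<beta> where \<alpha>: "\<alpha> > 0" and \<beta>: "\<beta> \<ge> 0" and diss: "\<And>p z. (\<Sum>i\<in>UNIV. \<omega> i * p i) = 0 \<Longrightarrow>
    (\<Sum>i\<in>UNIV. \<omega> i * p i * (- \<rho> * (\<Sum>j\<in>UNIV. A $ i $ j * ((p i + z i) - (p j + z j)))))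
      \<le> - \<alpha> * (\<Sum>i\<in>UNIV. (p i)\<^sup>2) + \<beta> * (\<Sum>i\<in>UNIV. (z i)\<^sup>2)"
    by (rule network_dissipation[where \<omega> = \<omega>, OF adj conn \<omega> \<rho>]) (rule that, assumption, assumption, blast)
  define D where "D = (\<Sum>i\<in>UNIV. \<omega> i * (p0 i)\<^sup>2 / 2) + \<beta> * (\<Sum>i\<in>(UNIV::'n set). max 0 M)"
  have D0: "D \<ge> 0"
    unfolding D_def using \<omega>(2) \<beta>
    by (intro add_nonneg_nonneg mult_nonneg_nonneg sum_nonneg) (auto simp: less_imp_le)
  define C where "C = 1 + (\<Sum>i\<in>UNIV. 2 * D / \<omega> i) + D / \<alpha>"
  show thesis
  proof (rule that[of C])
    fix T :: real and p z :: "'n \<Rightarrow> real \<Rightarrow> real"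
    assume T: "T \<ge> 0" and init: "\<And>i. p i 0 = p0 i"
      and cz: "\<And>i. continuous_on {0..T} (z i)"
      and M: "\<And>i. integral {0..T} (\<lambda>s. (z i s)\<^sup>2) \<le> M"
      and dp: "\<And>i t. t \<in> {0..T} \<Longrightarrow> (p i has_real_derivative
         - \<rho> * (\<Sum>j\<in>UNIV. A $ i $ j * ((p i t + z i t) - (p j t + z j t)))) (at t within {0..T})"
    have TT: "T \<in> {0..T}" "0 \<in> {0..T}" using T by auto
    have cp: "continuous_on {0..T} (p i)" for i using dp by (rule DERIV_continuous_on)
    \<comment> \<open>The dissipation inequality is available only at zero weighted mean, which the
      flow preserves for every input \<open>z\<close>.\<close>
    have "((\<lambda>t. \<Sum>i\<in>UNIV. \<omega> i * p i t) has_real_derivative 0) (at t within {0..T})"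
      if t: "t \<in> {0..T}" for t
    proof -
      have "((\<lambda>t. \<Sum>i\<in>UNIV. \<omega> i * p i t) has_real_derivative (\<Sum>i\<in>UNIV. \<omega> i *
          (- \<rho> * (\<Sum>j\<in>UNIV. A $ i $ j * ((p i t + z i t) - (p j t + z j t)))))) (at t within {0..T})"
        by (intro DERIV_sum DERIV_cmult dp t)
      also have "(\<Sum>i\<in>UNIV. \<omega> i *
          (- \<rho> * (\<Sum>j\<in>UNIV. A $ i $ j * ((p i t + z i t) - (p j t + z j t)))))
        = - \<rho> * (\<Sum>i\<in>UNIV. \<Sum>j\<in>UNIV. \<omega> i * A $ i $ j * ((p i t + z i t) - (p j t + z j t)))"
        unfolding sum_distrib_left by (intro sum.cong refl) (simp add: mult_ac)
      also have "\<dots> = 0"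
        using balanced_sum_diff_eq_0[OF \<omega>(1), of "\<lambda>i. p i t + z i t"] by simp
      finally show ?thesis .
    qed
    then obtain c where "\<And>t. t \<in> {0..T} \<Longrightarrow> (\<Sum>i\<in>UNIV. \<omega> i * p i t) = c"
      using has_field_derivative_zero_constant[of "{0..T}" "\<lambda>t. \<Sum>i\<in>UNIV. \<omega> i * p i t"] by auto
    then have mean: "(\<Sum>i\<in>UNIV. \<omega> i * p i t) = 0" if "t \<in> {0..T}" for t
      using that TT(2) p0 init by fastforce
    have dI: "((\<lambda>t. integral {0..t} (\<lambda>s. (g s)\<^sup>2)) has_real_derivative (g t)\<^sup>2) (at t within {0..T})"
      if "continuous_on {0..T} g" "t \<in> {0..T}" for g :: "real \<Rightarrow> real" and t
      by (rule integral_has_real_derivative[OF _ that(2)]) (intro continuous_intros that)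
    define H where "H t = (\<Sum>i\<in>UNIV. \<omega> i * (p i t)\<^sup>2 / 2)
      + \<alpha> * (\<Sum>i\<in>UNIV. integral {0..t} (\<lambda>s. (p i s)\<^sup>2))
      - \<beta> * (\<Sum>i\<in>UNIV. integral {0..t} (\<lambda>s. (z i s)\<^sup>2))" for t
    define H' where "H' t = (\<Sum>i\<in>UNIV. \<omega> i * p i t *
        (- \<rho> * (\<Sum>j\<in>UNIV. A $ i $ j * ((p i t + z i t) - (p j t + z j t)))))
      + \<alpha> * (\<Sum>i\<in>UNIV. (p i t)\<^sup>2) - \<beta> * (\<Sum>i\<in>UNIV. (z i t)\<^sup>2)" for t
    have dH: "(H has_real_derivative H' t) (at t within {0..T})" if t: "t \<in> {0..T}" for t
      unfolding H_def[abs_def] H'_def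
    proof (intro DERIV_diff DERIV_add DERIV_cmult DERIV_sum dI cp cz t)
      fix i
      show "((\<lambda>t. \<omega> i * (p i t)\<^sup>2 / 2) has_real_derivative \<omega> i * p i t *
        (- \<rho> * (\<Sum>j\<in>UNIV. A $ i $ j * ((p i t + z i t) - (p j t + z j t))))) (at t within {0..T})"
        by (auto intro!: derivative_eq_intros dp[OF t])
    qed
    have hi: "(H' has_integral H T - H 0) {0..T}"
      by (rule fundamental_theorem_of_calculus[OF T])
        (use dH in \<open>auto simp: has_real_derivative_iff_has_vector_derivative\<close>)
    have neg: "H' t \<le> 0" if "t \<in> {0..T}" for t
      using diss[of "\<lambda>i. p i t" "\<lambda>i. z i t", OF mean[OF that]] unfolding H'_def by simp
    have "H T - H 0 \<le> 0"
      by (rule has_integral_le[OF hi has_integral_0 neg])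
    moreover have "H 0 = (\<Sum>i\<in>UNIV. \<omega> i * (p0 i)\<^sup>2 / 2)" by (simp add: H_def init)
    moreover have "\<beta> * (\<Sum>i\<in>UNIV. integral {0..T} (\<lambda>s. (z i s)\<^sup>2)) \<le> \<beta> * (\<Sum>i\<in>(UNIV::'n set). max 0 M)"
      using M \<beta> by (intro mult_left_mono sum_mono) (auto simp: le_max_iff_disj)
    ultimately have E: "(\<Sum>i\<in>UNIV. \<omega> i * (p i T)\<^sup>2 / 2)
        + \<alpha> * (\<Sum>i\<in>UNIV. integral {0..T} (\<lambda>s. (p i s)\<^sup>2)) \<le> D"
      by (simp add: H_def D_def)
    have n1: "\<omega> i * (p i T)\<^sup>2 / 2 \<ge> 0" for i using \<omega>(2)[of i] by simp
    have n2: "integral {0..T} (\<lambda>s. (p i s)\<^sup>2) \<ge> 0" for i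
      by (intro integral_nonneg integrable_continuous_real continuous_intros cp) auto
    show "\<forall>i. \<bar>p i T\<bar> \<le> C \<and> integral {0..T} (\<lambda>s. (p i s)\<^sup>2) \<le> C"
    proof (intro allI conjI)
      fix i
      have "\<omega> i * (p i T)\<^sup>2 / 2 \<le> (\<Sum>i\<in>UNIV. \<omega> i * (p i T)\<^sup>2 / 2)"
        by (rule member_le_sum) (use n1 in auto)
      also have "\<dots> \<le> D"
        using E \<alpha> n2 by (smt (verit) mult_nonneg_nonneg sum_nonneg)
      finally have "(p i T)\<^sup>2 \<le> 2 * D / \<omega> i" using \<omega>(2)[of i] by (simp add: field_simps)
      moreover have "2 * D / \<omega> i \<le> (\<Sum>i\<in>UNIV. 2 * D / \<omega> i)"
        by (rule member_le_sum) (use D0 \<omega>(2) in \<open>auto simp: less_imp_le\<close>)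
      moreover have "0 \<le> (\<bar>p i T\<bar> - 1)\<^sup>2" by simp
      then have "\<bar>p i T\<bar> \<le> 1 + (p i T)\<^sup>2"
        unfolding power2_diff by simp
      moreover have D\<alpha>: "0 \<le> D / \<alpha>" using D0 \<alpha> by simp
      ultimately show "\<bar>p i T\<bar> \<le> C" unfolding C_def by linarith
      have "integral {0..T} (\<lambda>s. (p i s)\<^sup>2) \<le> (\<Sum>i\<in>UNIV. integral {0..T} (\<lambda>s. (p i s)\<^sup>2))"
        by (rule member_le_sum) (use n2 in auto)
      also have "\<dots> \<le> D / \<alpha>"
      proof -
        have "(\<Sum>i\<in>UNIV. \<omega> i * (p i T)\<^sup>2 / 2) \<ge> 0" by (intro sum_nonneg n1)
        then show ?thesis using E \<alpha> by (simp add: field_simps)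
      qed
      also have "\<dots> \<le> C"
        unfolding C_def using D0 \<omega>(2) by (auto intro!: add_nonneg_nonneg sum_nonneg simp: less_imp_le)
      finally show "integral {0..T} (\<lambda>s. (p i s)\<^sup>2) \<le> C" .
    qed
  qed
qed

section \<open>The closed loop as an autonomous system\<close>

text \<open>One index type for all scalar states, since the parameter vectors of the agents differ
  in length. Making the integral a state, \<open>Err_int\<close>, turns the integro-differential
  closed loop into an ordinary differential equation.\<close>

datatype 'n coord = Pos 'n | Err_int 'n | Gain 'n | Param 'n nat

locale adaptive_consensus =
  fixes E :: "('n::finite \<times> 'n) set"
    and A :: "real^'n^'n"
    and b :: "'n \<Rightarrow> real"
    and l :: "'n \<Rightarrow> nat"
    and \<theta> :: "'n \<Rightarrow> nat \<Rightarrow> real"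
    and \<phi> :: "'n \<Rightarrow> real \<Rightarrow> nat \<Rightarrow> real"
    and \<rho> \<nu> :: real
    and \<gamma> xbar :: "'n \<Rightarrow> real"
    and \<omega> :: "real^'n"
  assumes adj: "adjacency_matrix E A"
    and conn: "strongly_connected E"
    and b: "b i \<noteq> 0"
    and \<phi>: "k < l i \<Longrightarrow> smooth (\<lambda>y. \<phi> i y k)"
    and \<rho>: "\<rho> > 0" and \<nu>: "\<nu> > 0" and \<gamma>: "\<gamma> i > 0"
    and \<omega>: "\<omega> v* laplacian A = 0"
    and \<omega>_sum: "(\<Sum>k\<in>UNIV. \<omega> $ k) = 1"
begin

definition coords :: "'n coord set" where
  "coords = range Pos \<union> range Err_int \<union> range Gain \<union> (\<Union>i. Param i ` {..<l i})"

definition err :: "'n \<Rightarrow> ('n coord \<Rightarrow> real) \<Rightarrow> real" where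
  "err i a = (\<Sum>j\<in>neighbours E i. A $ i $ j * (a (Pos i) - a (Pos j)))"

definition zed :: "'n \<Rightarrow> ('n coord \<Rightarrow> real) \<Rightarrow> real" where
  "zed i a = a (Pos i) - xbar i + \<rho> * a (Err_int i)"

definition est :: "'n \<Rightarrow> ('n coord \<Rightarrow> real) \<Rightarrow> real" where
  "est i a = dotp (l i) (\<lambda>k. a (Param i k)) (\<phi> i (a (Pos i))) + \<rho> * err i a"

definition inp :: "'n \<Rightarrow> ('n coord \<Rightarrow> real) \<Rightarrow> real" where
  "inp i a = nussbaum (a (Gain i)) * (est i a + \<nu> * zed i a)"

fun field :: "'n coord \<Rightarrow> ('n coord \<Rightarrow> real) \<Rightarrow> real" where
  "field (Pos i) a = b i * inp i a + dotp (l i) (\<theta> i) (\<phi> i (a (Pos i)))"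
| "field (Err_int i) a = err i a"
| "field (Gain i) a = \<nu> * (zed i a)\<^sup>2 + zed i a * est i a"
| "field (Param i k) a = \<gamma> i * \<phi> i (a (Pos i)) k * zed i a"

definition solves :: "real set \<Rightarrow> ('n coord \<Rightarrow> real \<Rightarrow> real) \<Rightarrow> bool" where
  "solves S y \<longleftrightarrow> (\<forall>c\<in>coords. \<forall>t\<in>S.
     (y c has_real_derivative field c (\<lambda>c. y c t)) (at t within S))"

definition starts ::
  "('n \<Rightarrow> real) \<Rightarrow> ('n \<Rightarrow> nat \<Rightarrow> real) \<Rightarrow> ('n \<Rightarrow> real) \<Rightarrow> ('n coord \<Rightarrow> real \<Rightarrow> real) \<Rightarrow> bool" where
  "starts x0 \<theta>h0 \<zeta>0 y \<longleftrightarrow> (\<forall>i. y (Pos i) 0 = x0 i \<and> y (Err_int i) 0 = 0 \<and> y (Gain i) 0 = \<zeta>0 i \<and>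
     (\<forall>k<l i. y (Param i k) 0 = \<theta>h0 i k))"

definition target :: real where
  "target = (\<Sum>k\<in>UNIV. \<omega> $ k * xbar k)"

lemma finite_coords [simp]: "finite coords"
  by (simp add: coords_def)

lemma in_coords [simp]:
  "Pos i \<in> coords" "Err_int i \<in> coords" "Gain i \<in> coords" "Param i k \<in> coords \<longleftrightarrow> k < l i"
  by (auto simp: coords_def)

lemma coordsE:
  assumes "c \<in> coords"
  obtains i where "c = Pos i" | i where "c = Err_int i" | i where "c = Gain i"
    | i k where "k < l i" "c = Param i k"
  using assms by (auto simp: coords_def)

lemma \<omega>_balanced: "balanced A (\<lambda>i. \<omega> $ i)"
  by (rule left_null_vector_balanced[OF \<omega>])

lemma \<omega>_pos: "\<omega> $ i > 0"
  by (rule left_null_vector_pos[OF adj conn \<omega>_balanced \<omega>_sum])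

lemma sum_neighbours: "(\<Sum>j\<in>neighbours E i. A $ i $ j * f j) = (\<Sum>j\<in>UNIV. A $ i $ j * f j)"
  using adj by (intro sum.mono_neutral_left) (auto simp: neighbours_def adjacency_matrix_def)

lemma solves_subset: "solves T y \<Longrightarrow> S \<subseteq> T \<Longrightarrow> solves S y"
  unfolding solves_def by (meson DERIV_subset subsetD)

section \<open>Local Lipschitz continuity of the vector field\<close>

lemma smooth_composed_coord:
  assumes "k < l i"
  shows "lipschitz_on_boxes coords (\<lambda>a. \<phi> i (a (Pos i)) k)"
proof (rule lipschitz_on_boxes_compose[where h = "\<lambda>y. \<phi> i y k"])
  show "lipschitz_on_boxes coords (\<lambda>a. a (Pos i))" by (rule lipschitz_on_boxes_coord) auto
  have s: "(deriv ^^ n) (\<lambda>y. \<phi> i y k) field_differentiable at x" for n x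
    using \<phi>[OF assms] by (simp add: smooth_def)
  show "((\<lambda>y. \<phi> i y k) has_real_derivative deriv (\<lambda>y. \<phi> i y k) x) (at x)" for x
    using s[of 0 x] by (simp add: field_differentiable_derivI)
  show "continuous_on UNIV (deriv (\<lambda>y. \<phi> i y k))"
    using s[of 1] by (intro continuous_at_imp_continuous_on ballI field_differentiable_imp_continuous_at) simp
qed

lemma lipschitz_dotp:
  assumes "\<And>k. k < n \<Longrightarrow> lipschitz_on_boxes J (\<lambda>a. f a k)"
    and "\<And>k. k < n \<Longrightarrow> lipschitz_on_boxes J (\<lambda>a. g a k)"
  shows "lipschitz_on_boxes J (\<lambda>a. dotp n (f a) (g a))"
  unfolding dotp_def using assms
  by (intro lipschitz_on_boxes_sum lipschitz_on_boxes_mult) auto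

lemma lipschitz_err: "lipschitz_on_boxes coords (err i)"
  unfolding err_def[abs_def]
  by (intro lipschitz_on_boxes_sum lipschitz_on_boxes_mult lipschitz_on_boxes_diff
      lipschitz_on_boxes_const lipschitz_on_boxes_coord) auto

lemma lipschitz_zed: "lipschitz_on_boxes coords (zed i)"
  unfolding zed_def[abs_def]
  by (intro lipschitz_on_boxes_add lipschitz_on_boxes_mult lipschitz_on_boxes_diff
      lipschitz_on_boxes_const lipschitz_on_boxes_coord) auto

lemma lipschitz_est: "lipschitz_on_boxes coords (est i)"
  unfolding est_def[abs_def]
  by (intro lipschitz_on_boxes_add lipschitz_on_boxes_mult lipschitz_on_boxes_const lipschitz_err
      lipschitz_dotp lipschitz_on_boxes_coord smooth_composed_coord) auto

lemma lipschitz_inp: "lipschitz_on_boxes coords (inp i)"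
proof -
  have "lipschitz_on_boxes coords (\<lambda>a. nussbaum (a (Gain i)))"
  proof (rule lipschitz_on_boxes_compose[where h = nussbaum])
    show "lipschitz_on_boxes coords (\<lambda>a. a (Gain i))" by (rule lipschitz_on_boxes_coord) auto
    show "(nussbaum has_real_derivative 2 * k * cos k - k\<^sup>2 * sin k) (at k)" for k
      unfolding nussbaum_def[abs_def] by (auto intro!: derivative_eq_intros)
    show "continuous_on UNIV (\<lambda>k::real. 2 * k * cos k - k\<^sup>2 * sin k)" by (intro continuous_intros)
  qed
  then show ?thesis
    unfolding inp_def[abs_def]
    by (intro lipschitz_on_boxes_add lipschitz_on_boxes_mult lipschitz_on_boxes_const lipschitz_est lipschitz_zed)
qed

lemma lipschitz_field:
  assumes "c \<in> coords"
  shows "lipschitz_on_boxes coords (field c)"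
  using assms
proof (cases rule: coordsE)
  case (1 i)
  have "lipschitz_on_boxes coords (\<lambda>a. b i * inp i a + dotp (l i) (\<theta> i) (\<phi> i (a (Pos i))))"
    by (intro lipschitz_on_boxes_add lipschitz_on_boxes_mult lipschitz_on_boxes_const lipschitz_inp
        lipschitz_dotp smooth_composed_coord)
  moreover have "field c = (\<lambda>a. b i * inp i a + dotp (l i) (\<theta> i) (\<phi> i (a (Pos i))))"
    using 1 by auto
  ultimately show ?thesis by simp
next
  case (2 i)
  then have "field c = err i" by auto
  then show ?thesis using lipschitz_err by simp
next
  case (3 i)
  have "lipschitz_on_boxes coords (\<lambda>a. \<nu> * (zed i a * zed i a) + zed i a * est i a)"
    by (intro lipschitz_on_boxes_add lipschitz_on_boxes_mult lipschitz_on_boxes_const lipschitz_zed lipschitz_est)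
  moreover have "field c = (\<lambda>a. \<nu> * (zed i a * zed i a) + zed i a * est i a)"
    using 3 by (auto simp: power2_eq_square)
  ultimately show ?thesis by simp
next
  case (4 i k)
  have "lipschitz_on_boxes coords (\<lambda>a. \<gamma> i * \<phi> i (a (Pos i)) k * zed i a)"
    using 4 by (intro lipschitz_on_boxes_mult lipschitz_on_boxes_const lipschitz_zed smooth_composed_coord)
  moreover have "field c = (\<lambda>a. \<gamma> i * \<phi> i (a (Pos i)) k * zed i a)"
    using 4 by auto
  ultimately show ?thesis by simp
qed

section \<open>Decoupling into single agents and a driven network\<close>

lemma zed_derivative:
  assumes "solves S y" "t \<in> S"
  shows "((\<lambda>s. zed i (\<lambda>c. y c s)) has_real_derivative
    field (Pos i) (\<lambda>c. y c t) + \<rho> * err i (\<lambda>c. y c t)) (at t within S)"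
proof -
  have "(y (Pos i) has_real_derivative field (Pos i) (\<lambda>c. y c t)) (at t within S)"
    "(y (Err_int i) has_real_derivative field (Err_int i) (\<lambda>c. y c t)) (at t within S)"
    using assms by (simp_all add: solves_def del: field.simps)
  then show ?thesis unfolding zed_def by (auto intro!: derivative_eq_intros)
qed

text \<open>This cuts the mutual dependence of the agents: the others enter agent \<open>i\<close>
  only through \<open>\<rho> * err i\<close>, which \<open>agent_energy_bound\<close> accepts as an
  arbitrary function of time.\<close>

lemma solves_agent_loop:
  assumes "solves S y"
  shows "agent_loop (b i) (l i) (\<theta> i) \<nu> (\<gamma> i) S (\<lambda>s. zed i (\<lambda>c. y c s)) (\<lambda>s k. y (Param i k) s)
    (y (Gain i)) (\<lambda>s. \<phi> i (y (Pos i) s)) (\<lambda>s. \<rho> * err i (\<lambda>c. y c s))"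
  unfolding agent_loop_def
proof (intro ballI conjI allI impI)
  fix t assume t: "t \<in> S"
  show "((\<lambda>s. zed i (\<lambda>c. y c s)) has_real_derivative
      b i * (nussbaum (y (Gain i) t) * (dotp (l i) (\<lambda>k. y (Param i k) t) (\<phi> i (y (Pos i) t)) +
        \<rho> * err i (\<lambda>c. y c t) + \<nu> * zed i (\<lambda>c. y c t))) +
      dotp (l i) (\<theta> i) (\<phi> i (y (Pos i) t)) + \<rho> * err i (\<lambda>c. y c t)) (at t within S)"
    using zed_derivative[OF assms t, of i] by (simp add: inp_def est_def)
  have *: "(y c has_real_derivative field c (\<lambda>c. y c t)) (at t within S)" if "c \<in> coords" for c
    using assms t that by (simp add: solves_def)
  show "(y (Param i k) has_real_derivative \<gamma> i * \<phi> i (y (Pos i) t) k * zed i (\<lambda>c. y c t)) (at t within S)"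
    if "k < l i" for k using *[of "Param i k"] that by simp
  show "(y (Gain i) has_real_derivative \<nu> * (zed i (\<lambda>c. y c t))\<^sup>2 + zed i (\<lambda>c. y c t) *
      (dotp (l i) (\<lambda>k. y (Param i k) t) (\<phi> i (y (Pos i) t)) + \<rho> * err i (\<lambda>c. y c t))) (at t within S)"
    using *[of "Gain i"] by (simp add: est_def)
qed

text \<open>\<open>xbar i - \<rho> w\<^sub>i - target\<close> is the state of a consensus protocol driven by \<open>z\<close>, with zero
  \<open>\<omega>\<close>-weighted mean.\<close>

definition dev :: "'n \<Rightarrow> ('n coord \<Rightarrow> real) \<Rightarrow> real" where
  "dev i a = xbar i - \<rho> * a (Err_int i) - target"

lemma pos_eq: "a (Pos i) = dev i a + zed i a + target"
  by (simp add: dev_def zed_def)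

lemma dev_derivative:
  assumes "solves S y" "t \<in> S"
  shows "((\<lambda>s. dev i (\<lambda>c. y c s)) has_real_derivative - \<rho> * err i (\<lambda>c. y c t)) (at t within S)"
proof -
  have "(y (Err_int i) has_real_derivative err i (\<lambda>c. y c t)) (at t within S)"
    using assms in_coords(2)[of i] unfolding solves_def by (metis field.simps(2))
  then show ?thesis unfolding dev_def by (auto intro!: derivative_eq_intros)
qed

text \<open>\<open>target\<close> cancels in the differences of positions, so the coupling becomes a
  function of \<open>dev\<close> and \<open>zed\<close> alone, in the form that
  \<open>network_energy_bound\<close> expects.\<close>

lemma err_eq: "err i a = (\<Sum>j\<in>UNIV. A $ i $ j * ((dev i a + zed i a) - (dev j a + zed j a)))"
  unfolding err_def sum_neighbours by (simp add: pos_eq[of a])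

text \<open>The agent bounds come first and yield \<open>M\<close>; the network bound then takes
  \<open>M\<close> as its only information about \<open>z\<close>. Since \<open>C\<close> precedes
  \<open>T\<close> and \<open>y\<close>, the result serves both for existence on growing intervals
  and for boundedness and square integrability on the half-line.\<close>

lemma apriori_bound:
  obtains C where "\<And>T y. T \<ge> 0 \<Longrightarrow> solves {0..T} y \<Longrightarrow> starts x0 \<theta>h0 \<zeta>0 y \<Longrightarrow>
    (\<forall>c\<in>coords. \<bar>y c T\<bar> \<le> C) \<and>
    (\<forall>i. integral {0..T} (\<lambda>s. (zed i (\<lambda>c. y c s))\<^sup>2) \<le> C \<and>
         integral {0..T} (\<lambda>s. (dev i (\<lambda>c. y c s))\<^sup>2) \<le> C)"
proof -
  \<comment> \<open>The initial value of \<open>z\<close> is \<open>x0 i - xbar i\<close> because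
    the integral state starts at 0.\<close>
  define bnd where "bnd i C \<longleftrightarrow> (\<forall>T\<ge>0. \<forall>z \<theta>h \<zeta> \<phi> r.
      agent_loop (b i) (l i) (\<theta> i) \<nu> (\<gamma> i) {0..T} z \<theta>h \<zeta> \<phi> r \<and>
      z 0 = x0 i - xbar i \<and> \<zeta> 0 = \<zeta>0 i \<and> (\<forall>k<l i. \<theta>h 0 k = \<theta>h0 i k) \<longrightarrow>
      \<bar>z T\<bar> \<le> C \<and> \<bar>\<zeta> T\<bar> \<le> C \<and> (\<forall>k<l i. \<bar>\<theta>h T k\<bar> \<le> C) \<and>
      integral {0..T} (\<lambda>s. (z s)\<^sup>2) \<le> C)" for i C
  have "\<exists>C. bnd i C" for i
    unfolding bnd_def by (rule agent_energy_bound[OF b \<nu> \<gamma>])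
  then obtain Cf where Cf: "\<And>i. bnd i (Cf i)" by metis
  define M where "M = (\<Sum>i\<in>UNIV. \<bar>Cf i\<bar>)"
  have CfM: "Cf i \<le> M" for i
    using member_le_sum[of i UNIV "\<lambda>i. \<bar>Cf i\<bar>"] by (simp add: M_def)
  have M0: "M \<ge> 0" by (simp add: M_def sum_nonneg)
  have mean: "(\<Sum>i\<in>UNIV. \<omega> $ i * (xbar i - target)) = 0"
    using \<omega>_sum by (simp add: right_diff_distrib sum_subtractf target_def flip: sum_distrib_right)
  obtain D where D: "\<And>T p z. T \<ge> 0 \<Longrightarrow> (\<And>i. p i 0 = xbar i - target) \<Longrightarrow>
      (\<And>i. continuous_on {0..T} (z i)) \<Longrightarrow>
      (\<And>i. integral {0..T} (\<lambda>s. (z i s)\<^sup>2) \<le> M) \<Longrightarrow>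
      (\<And>i t. t \<in> {0..T} \<Longrightarrow> (p i has_real_derivative
         - \<rho> * (\<Sum>j\<in>UNIV. A $ i $ j * ((p i t + z i t) - (p j t + z j t)))) (at t within {0..T})) \<Longrightarrow>
      (\<forall>i. \<bar>p i T\<bar> \<le> D \<and> integral {0..T} (\<lambda>s. (p i s)\<^sup>2) \<le> D)"
    by (rule network_energy_bound[where \<omega> = "\<lambda>i. \<omega> $ i" and M = M, OF adj conn \<omega>_balanced \<omega>_pos \<rho> mean])
      (rule that, blast)
  \<comment> \<open>Bounds \<open>xbar i - target - p i T\<close>, which is \<open>\<rho>\<close>
    times the integral state; hence the quotient by \<open>\<rho>\<close> in
    \<open>C\<close>.\<close>
  define N where "N = (\<Sum>i\<in>UNIV. \<bar>xbar i\<bar>) + \<bar>target\<bar> + D"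
  define C where "C = M + \<bar>D\<bar> + \<bar>target\<bar> + \<bar>N\<bar> / \<rho>"
  show thesis
  proof (rule that[of C])
    fix T y assume T: "T \<ge> 0" and y: "solves {0..T} y" and init: "starts x0 \<theta>h0 \<zeta>0 y"
    define z where "z i s = zed i (\<lambda>c. y c s)" for i s
    define p where "p i s = dev i (\<lambda>c. y c s)" for i s
    have agent: "\<bar>z i T\<bar> \<le> M \<and> \<bar>y (Gain i) T\<bar> \<le> M \<and> (\<forall>k<l i. \<bar>y (Param i k) T\<bar> \<le> M) \<and>
        integral {0..T} (\<lambda>s. (z i s)\<^sup>2) \<le> M" for i
    proof -
      have "\<bar>z i T\<bar> \<le> Cf i \<and> \<bar>y (Gain i) T\<bar> \<le> Cf i \<and> (\<forall>k<l i. \<bar>y (Param i k) T\<bar> \<le> Cf i) \<and>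
          integral {0..T} (\<lambda>s. (z i s)\<^sup>2) \<le> Cf i"
        unfolding z_def
        by (rule Cf[of i, unfolded bnd_def, rule_format, OF T conjI[OF solves_agent_loop[OF y, of i]]])
          (use init in \<open>simp add: starts_def zed_def\<close>)
      then show ?thesis using CfM[of i] by force
    qed
    have net: "\<bar>p i T\<bar> \<le> D \<and> integral {0..T} (\<lambda>s. (p i s)\<^sup>2) \<le> D" for i
    proof (rule D[OF T, of p z, rule_format])
      show "p i 0 = xbar i - target" for i
        using init by (simp add: p_def dev_def starts_def)
      show "continuous_on {0..T} (z i)" for i
        unfolding z_def[abs_def] using zed_derivative[OF y] by (rule DERIV_continuous_on)
      show "integral {0..T} (\<lambda>s. (z i s)\<^sup>2) \<le> M" for i using agent by blast
      show "(p i has_real_derivative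
         - \<rho> * (\<Sum>j\<in>UNIV. A $ i $ j * ((p i t + z i t) - (p j t + z j t)))) (at t within {0..T})"
        if "t \<in> {0..T}" for i t
        using dev_derivative[OF y that, of i] unfolding p_def z_def err_eq .
    qed
    have N0: "0 \<le> \<bar>N\<bar> / \<rho>" using \<rho> by simp
    have "\<bar>y c T\<bar> \<le> C" if "c \<in> coords" for c
      using that
    proof (cases rule: coordsE)
      case (1 i)
      have "y (Pos i) T = p i T + z i T + target"
        unfolding p_def z_def by (rule pos_eq)
      then have "\<bar>y (Pos i) T\<bar> \<le> C" using net[of i] agent[of i] N0 unfolding C_def by linarith
      then show ?thesis using 1 by simp
    next
      case (2 i)
      have "\<bar>xbar i\<bar> \<le> (\<Sum>i\<in>UNIV. \<bar>xbar i\<bar>)" by (rule member_le_sum) auto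
      moreover have "\<rho> * y (Err_int i) T = xbar i - target - p i T" by (simp add: p_def dev_def)
      ultimately have "\<bar>\<rho> * y (Err_int i) T\<bar> \<le> \<bar>N\<bar>" using net[of i] unfolding N_def by linarith
      then have "\<bar>y (Err_int i) T\<bar> \<le> \<bar>N\<bar> / \<rho>" using \<rho> by (simp add: abs_mult field_simps)
      then have "\<bar>y (Err_int i) T\<bar> \<le> C" using M0 unfolding C_def by linarith
      then show ?thesis using 2 by simp
    next
      case (3 i)
      have "\<bar>y (Gain i) T\<bar> \<le> C" using agent[of i] N0 unfolding C_def by linarith
      then show ?thesis using 3 by simp
    next
      case (4 i k)
      then have "\<bar>y (Param i k) T\<bar> \<le> M" using agent by blast
      then have "\<bar>y (Param i k) T\<bar> \<le> C" using N0 unfolding C_def by linarith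
      then show ?thesis using 4 by simp
    qed
    moreover have "integral {0..T} (\<lambda>s. (z i s)\<^sup>2) \<le> C" "integral {0..T} (\<lambda>s. (p i s)\<^sup>2) \<le> C" for i
      using agent[of i] net[of i] N0 M0 unfolding C_def by linarith+
    ultimately show "(\<forall>c\<in>coords. \<bar>y c T\<bar> \<le> C) \<and>
      (\<forall>i. integral {0..T} (\<lambda>s. (zed i (\<lambda>c. y c s))\<^sup>2) \<le> C \<and>
           integral {0..T} (\<lambda>s. (dev i (\<lambda>c. y c s))\<^sup>2) \<le> C)"
      unfolding z_def p_def by blast
  qed
qed

section \<open>Existence, boundedness and convergence for the autonomous system\<close>

lemma solution_exists:
  "\<exists>y. solves {0..} y \<and> starts x0 \<theta>h0 \<zeta>0 y"
proof -
  define y0 where "y0 c = (case c of Pos i \<Rightarrow> x0 i | Err_int i \<Rightarrow> 0 | Gain i \<Rightarrow> \<zeta>0 i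
    | Param i k \<Rightarrow> \<theta>h0 i k)" for c
  obtain C where C: "\<And>T y. T \<ge> 0 \<Longrightarrow> solves {0..T} y \<Longrightarrow> starts x0 \<theta>h0 \<zeta>0 y \<Longrightarrow>
      \<forall>c\<in>coords. \<bar>y c T\<bar> \<le> C"
    by (rule apriori_bound) (rule that, blast)
  have starts: "starts x0 \<theta>h0 \<zeta>0 y" if "\<And>c. c \<in> coords \<Longrightarrow> y c 0 = y0 c" for y
    unfolding starts_def using that by (simp add: y0_def)
  have "\<exists>y. \<forall>c\<in>coords. y c 0 = y0 c \<and>
      (\<forall>t\<ge>0. (y c has_real_derivative field c (\<lambda>c. y c t)) (at t within {0..}))"
  proof (rule global_solution_of_apriori_bound[where C = C])
    show "\<bar>y c T\<bar> \<le> C"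
      if "T \<ge> 0" "\<And>c. c \<in> coords \<Longrightarrow> y c 0 = y0 c"
        "\<And>c t. c \<in> coords \<Longrightarrow> t \<in> {0..T} \<Longrightarrow>
           (y c has_real_derivative field c (\<lambda>c. y c t)) (at t within {0..T})"
        "c \<in> coords" for T y c
      using C[OF that(1) _ starts[of y, OF that(2)]] that(3,4) unfolding solves_def by blast
  qed (auto intro: lipschitz_field)
  then show ?thesis using starts unfolding solves_def by (metis atLeast_iff)
qed

lemma solution_bounded_and_convergent:
  assumes y: "solves {0..} y" and init: "starts x0 \<theta>h0 \<zeta>0 y"
  shows "c \<in> coords \<Longrightarrow> bounded_signal (y c)"
    and "lipschitz_on_boxes coords g \<Longrightarrow> bounded_signal (\<lambda>t. g (\<lambda>c. y c t))"
    and "(y (Pos i) \<longlongrightarrow> target) at_top"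
proof -
  obtain C where C: "\<And>T y. T \<ge> 0 \<Longrightarrow> solves {0..T} y \<Longrightarrow> starts x0 \<theta>h0 \<zeta>0 y \<Longrightarrow>
    (\<forall>c\<in>coords. \<bar>y c T\<bar> \<le> C) \<and>
    (\<forall>i. integral {0..T} (\<lambda>s. (zed i (\<lambda>c. y c s))\<^sup>2) \<le> C \<and>
         integral {0..T} (\<lambda>s. (dev i (\<lambda>c. y c s))\<^sup>2) \<le> C)"
    by (rule apriori_bound) (rule that, blast)
  have yT: "solves {0..T} y" for T by (rule solves_subset[OF y]) auto
  have box: "\<bar>y c t\<bar> \<le> C" if "t \<ge> 0" "c \<in> coords" for c t
    using C[OF that(1) yT init] that(2) by blast
  show "bounded_signal (y c)" if "c \<in> coords"
    unfolding bounded_signal_def bounded_iff using box[OF _ that] by auto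
  have lip: "\<exists>B. \<forall>t\<ge>0. \<bar>g (\<lambda>c. y c t)\<bar> \<le> B" if g: "lipschitz_on_boxes coords g" for g
  proof -
    obtain B where "B \<ge> 0" and B: "\<And>a. (\<And>c. c \<in> coords \<Longrightarrow> \<bar>a c\<bar> \<le> C) \<Longrightarrow> \<bar>g a\<bar> \<le> B"
      by (rule lipschitz_on_boxes_bounded[OF g, where R = C]) (rule that, assumption, blast)
    show ?thesis by (intro exI[of _ B] allI impI B box)
  qed
  show "bounded_signal (\<lambda>t. g (\<lambda>c. y c t))" if "lipschitz_on_boxes coords g"
    unfolding bounded_signal_def bounded_iff using lip[OF that] by auto
  \<comment> \<open>Square integrability is what is known, so Barbalat's lemma is applied to the
    square of the signal. Its derivative is \<open>2 * f * h\<close>, bounded because both factors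
    are functions Lipschitz on boxes of a bounded state.\<close>
  have sq: "((\<lambda>t. f (\<lambda>c. y c t)) \<longlongrightarrow> 0) at_top"
    if f: "lipschitz_on_boxes coords f" and h: "lipschitz_on_boxes coords h"
      and der: "\<And>t. t \<ge> 0 \<Longrightarrow>
        ((\<lambda>t. f (\<lambda>c. y c t)) has_real_derivative h (\<lambda>c. y c t)) (at t within {0..})"
      and int: "\<And>T. T \<ge> 0 \<Longrightarrow> integral {0..T} (\<lambda>s. (f (\<lambda>c. y c s))\<^sup>2) \<le> C" for f h
  proof -
    obtain K where K: "\<forall>t\<ge>0. \<bar>2 * f (\<lambda>c. y c t) * h (\<lambda>c. y c t)\<bar> \<le> K"
      using lip[OF lipschitz_on_boxes_mult[OF lipschitz_on_boxes_mult[OF lipschitz_on_boxes_const f] h]]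
      by blast
    have "((\<lambda>t. (f (\<lambda>c. y c t))\<^sup>2) \<longlongrightarrow> 0) at_top"
    proof (rule tendsto_zero_of_bounded_integral)
      show "((\<lambda>t. (f (\<lambda>c. y c t))\<^sup>2) has_real_derivative 2 * f (\<lambda>c. y c t) * h (\<lambda>c. y c t))
          (at t within {0..})" if "t \<ge> 0" for t
        using der[OF that] by (auto intro!: derivative_eq_intros)
      show "\<bar>2 * f (\<lambda>c. y c t) * h (\<lambda>c. y c t)\<bar> \<le> K" if "t \<ge> 0" for t
        using K that by blast
    qed (use int in auto)
    then show ?thesis by simp
  qed
  have "((\<lambda>t. zed i (\<lambda>c. y c t)) \<longlongrightarrow> 0) at_top"
  proof (rule sq[where h = "\<lambda>a. field (Pos i) a + \<rho> * err i a"])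
    show "lipschitz_on_boxes coords (\<lambda>a. field (Pos i) a + \<rho> * err i a)"
      by (intro lipschitz_on_boxes_add lipschitz_on_boxes_mult lipschitz_on_boxes_const
          lipschitz_field lipschitz_err in_coords)
    show "integral {0..T} (\<lambda>s. (zed i (\<lambda>c. y c s))\<^sup>2) \<le> C" if "T \<ge> 0" for T
      using C[OF that yT init] by blast
  qed (use zed_derivative[OF y] lipschitz_zed in auto)
  moreover have "((\<lambda>t. dev i (\<lambda>c. y c t)) \<longlongrightarrow> 0) at_top"
  proof (rule sq[where h = "\<lambda>a. - \<rho> * err i a"])
    show "lipschitz_on_boxes coords (dev i)"
      unfolding dev_def[abs_def]
      by (intro lipschitz_on_boxes_diff lipschitz_on_boxes_mult lipschitz_on_boxes_const
          lipschitz_on_boxes_coord) auto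
    show "lipschitz_on_boxes coords (\<lambda>a. - \<rho> * err i a)"
      by (intro lipschitz_on_boxes_mult lipschitz_on_boxes_const lipschitz_err)
    show "integral {0..T} (\<lambda>s. (dev i (\<lambda>c. y c s))\<^sup>2) \<le> C" if "T \<ge> 0" for T
      using C[OF that yT init] by blast
    show "((\<lambda>s. dev i (\<lambda>c. y c s)) has_real_derivative - \<rho> * err i (\<lambda>c. y c t)) (at t within {0..})"
      if "t \<ge> 0" for t
      using dev_derivative[OF y] that by simp
  qed
  ultimately have "((\<lambda>t. dev i (\<lambda>c. y c t) + zed i (\<lambda>c. y c t) + target) \<longlongrightarrow> 0 + 0 + target) at_top"
    by (intro tendsto_intros)
  then show "(y (Pos i) \<longlongrightarrow> target) at_top"
    by (simp add: pos_eq[symmetric])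
qed

section \<open>Translation between the autonomous system and the closed loop\<close>

lemma err_consensus_error:
  "err i (\<lambda>c. y c t) = consensus_error E A (\<lambda>i. y (Pos i)) i t"
  by (simp add: err_def consensus_error_def)

text \<open>In the autonomous system the integral is an independent state; its initial value 0
  identifies it with the integral in the control law.\<close>

lemma solves_consensus_integral:
  assumes y: "solves {0..} y" and "y (Err_int i) 0 = 0" "t \<ge> 0"
  shows "consensus_integral E A (\<lambda>i. y (Pos i)) i t = y (Err_int i) t"
proof -
  have "(consensus_error E A (\<lambda>i. y (Pos i)) i has_integral y (Err_int i) t - y (Err_int i) 0) {0..t}"
  proof (rule fundamental_theorem_of_calculus[OF \<open>t \<ge> 0\<close>])
    fix s assume s: "s \<in> {0..t}"
    have "solves {0..t} y" by (rule solves_subset[OF y]) auto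
    then have "(y (Err_int i) has_real_derivative field (Err_int i) (\<lambda>c. y c s)) (at s within {0..t})"
      using s in_coords(2)[of i] unfolding solves_def by blast
    then show "(y (Err_int i) has_vector_derivative consensus_error E A (\<lambda>i. y (Pos i)) i s) (at s within {0..t})"
      by (simp add: has_real_derivative_iff_has_vector_derivative err_consensus_error)
  qed
  then show ?thesis using assms(2) unfolding consensus_integral_def by (simp add: integral_unique)
qed

definition signals ::
  "('n \<Rightarrow> real \<Rightarrow> real) \<Rightarrow> ('n \<Rightarrow> real \<Rightarrow> nat \<Rightarrow> real) \<Rightarrow> ('n \<Rightarrow> real \<Rightarrow> real) \<Rightarrow>
   'n coord \<Rightarrow> real \<Rightarrow> real" where
  "signals x \<theta>hat \<zeta> c = (case c of Pos i \<Rightarrow> x i | Err_int i \<Rightarrow> consensus_integral E A x i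
     | Gain i \<Rightarrow> \<zeta> i | Param i k \<Rightarrow> (\<lambda>t. \<theta>hat i t k))"

lemma signals_simps [simp]:
  "signals x \<theta>hat \<zeta> (Pos i) = x i"
  "signals x \<theta>hat \<zeta> (Err_int i) = consensus_integral E A x i"
  "signals x \<theta>hat \<zeta> (Gain i) = \<zeta> i"
  "signals x \<theta>hat \<zeta> (Param i k) = (\<lambda>t. \<theta>hat i t k)"
  by (simp_all add: signals_def)

lemma signals_functionals:
  "err i (\<lambda>c. signals x \<theta>hat \<zeta> c t) = consensus_error E A x i t"
  "zed i (\<lambda>c. signals x \<theta>hat \<zeta> c t) = z_signal E A \<rho> xbar x i t"
  "inp i (\<lambda>c. signals x \<theta>hat \<zeta> c t) = control E A l \<phi> \<rho> \<nu> xbar x \<theta>hat \<zeta> i t"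
  by (simp_all add: err_def zed_def inp_def est_def consensus_error_def z_signal_def control_def)

text \<open>This direction extends the conclusions from the constructed solution to every solution
  of the closed loop. Positions are continuous because they are differentiable, which makes the
  integral coordinate differentiable as well.\<close>

lemma closed_loop_imp_solves:
  assumes "closed_loop E A b l \<theta> \<phi> \<rho> \<nu> \<gamma> xbar x \<theta>hat \<zeta>"
  shows "solves {0..} (signals x \<theta>hat \<zeta>)"
  unfolding solves_def
proof (intro ballI)
  fix c t assume "c \<in> coords" and t: "t \<in> {0::real..}"
  note cl = assms[unfolded closed_loop_def, rule_format]
  have cx: "continuous_on {0..} (x i)" for i
    using cl by (intro DERIV_continuous_on) auto
  from \<open>c \<in> coords\<close> show "(signals x \<theta>hat \<zeta> c has_real_derivative
    field c (\<lambda>c. signals x \<theta>hat \<zeta> c t)) (at t within {0..})"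
  proof (cases rule: coordsE)
    case (2 i)
    have "continuous_on {0..} (consensus_error E A x i)"
      unfolding consensus_error_def[abs_def] by (intro continuous_intros cx)
    then show ?thesis
      using 2 t integral_has_real_derivative_Ici[of 0 "consensus_error E A x i" t]
      by (simp add: signals_functionals consensus_integral_def[abs_def])
  qed (use cl t in \<open>auto simp: signals_functionals est_def\<close>)
qed

lemma initial_condition_starts:
  "initial_condition l x0 \<theta>hat0 \<zeta>0 x \<theta>hat \<zeta> \<longleftrightarrow> starts x0 \<theta>hat0 \<zeta>0 (signals x \<theta>hat \<zeta>)"
  by (auto simp: initial_condition_def starts_def consensus_integral_def)

lemma solves_imp_closed_loop:
  assumes y: "solves {0..} y" and init: "\<And>i. y (Err_int i) 0 = 0"
  shows "closed_loop E A b l \<theta> \<phi> \<rho> \<nu> \<gamma> xbar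
    (\<lambda>i. y (Pos i)) (\<lambda>i t k. y (Param i k) t) (\<lambda>i. y (Gain i))"
  unfolding closed_loop_def
proof (intro allI impI)
  fix i and t :: real assume t: "t \<ge> 0"
  have d: "(y c has_real_derivative field c (\<lambda>c. y c t)) (at t within {0..})" if "c \<in> coords" for c
    using y t that by (auto simp: solves_def)
  have z: "z_signal E A \<rho> xbar (\<lambda>i. y (Pos i)) i t = zed i (\<lambda>c. y c t)"
    using solves_consensus_integral[OF y init t, of i] by (simp add: z_signal_def zed_def)
  have u: "control E A l \<phi> \<rho> \<nu> xbar (\<lambda>i. y (Pos i)) (\<lambda>i t k. y (Param i k) t) (\<lambda>i. y (Gain i)) i t
      = inp i (\<lambda>c. y c t)"
    by (simp add: control_def inp_def est_def z err_consensus_error)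
  show "(y (Pos i) has_real_derivative
        b i * control E A l \<phi> \<rho> \<nu> xbar (\<lambda>i. y (Pos i)) (\<lambda>i t k. y (Param i k) t) (\<lambda>i. y (Gain i)) i t
        + dotp (l i) (\<theta> i) (\<phi> i (y (Pos i) t))) (at t within {0..}) \<and>
    (\<forall>k<l i. (y (Param i k) has_real_derivative
        \<gamma> i * \<phi> i (y (Pos i) t) k * z_signal E A \<rho> xbar (\<lambda>i. y (Pos i)) i t) (at t within {0..})) \<and>
    (y (Gain i) has_real_derivative
        \<nu> * (z_signal E A \<rho> xbar (\<lambda>i. y (Pos i)) i t)\<^sup>2 + z_signal E A \<rho> xbar (\<lambda>i. y (Pos i)) i t *
          (dotp (l i) (\<lambda>k. y (Param i k) t) (\<phi> i (y (Pos i) t))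
           + \<rho> * consensus_error E A (\<lambda>i. y (Pos i)) i t)) (at t within {0..})"
    unfolding u z using d[of "Pos i"] d[of "Gain i"] d[of "Param i _"]
    by (simp add: est_def err_consensus_error)
qed

lemma closed_loop_exists:
  "\<exists>x \<theta>hat \<zeta>. closed_loop E A b l \<theta> \<phi> \<rho> \<nu> \<gamma> xbar x \<theta>hat \<zeta> \<and>
     initial_condition l x0 \<theta>hat0 \<zeta>0 x \<theta>hat \<zeta>"
proof -
  obtain y where y: "solves {0..} y" and init: "starts x0 \<theta>hat0 \<zeta>0 y"
    using solution_exists by blast
  have "closed_loop E A b l \<theta> \<phi> \<rho> \<nu> \<gamma> xbar
      (\<lambda>i. y (Pos i)) (\<lambda>i t k. y (Param i k) t) (\<lambda>i. y (Gain i))"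
    by (rule solves_imp_closed_loop[OF y]) (use init in \<open>simp add: starts_def\<close>)
  moreover have "initial_condition l x0 \<theta>hat0 \<zeta>0
      (\<lambda>i. y (Pos i)) (\<lambda>i t k. y (Param i k) t) (\<lambda>i. y (Gain i))"
    using init by (simp add: initial_condition_def starts_def)
  ultimately show ?thesis by blast
qed

lemma closed_loop_bounded_and_convergent:
  assumes "closed_loop E A b l \<theta> \<phi> \<rho> \<nu> \<gamma> xbar x \<theta>hat \<zeta>"
    and "initial_condition l x0 \<theta>hat0 \<zeta>0 x \<theta>hat \<zeta>"
  shows "bounded_signal (x i)" "bounded_signal (z_signal E A \<rho> xbar x i)"
    "bounded_signal (consensus_integral E A x i)"
    "k < l i \<Longrightarrow> bounded_signal (\<lambda>t. \<theta>hat i t k)" "bounded_signal (\<zeta> i)"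
    "bounded_signal (control E A l \<phi> \<rho> \<nu> xbar x \<theta>hat \<zeta> i)"
    "(x i \<longlongrightarrow> (\<Sum>k\<in>UNIV. \<omega> $ k * xbar k)) at_top"
proof -
  note main = solution_bounded_and_convergent[OF closed_loop_imp_solves[OF assms(1)]
      assms(2)[unfolded initial_condition_starts]]
  show "bounded_signal (x i)" "bounded_signal (consensus_integral E A x i)"
    "k < l i \<Longrightarrow> bounded_signal (\<lambda>t. \<theta>hat i t k)" "bounded_signal (\<zeta> i)"
    using main(1)[of "Pos i"] main(1)[of "Err_int i"] main(1)[of "Param i k"] main(1)[of "Gain i"]
    by simp_all
  show "bounded_signal (z_signal E A \<rho> xbar x i)"
    "bounded_signal (control E A l \<phi> \<rho> \<nu> xbar x \<theta>hat \<zeta> i)"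
    using main(2)[OF lipschitz_zed[of i]] main(2)[OF lipschitz_inp[of i]]
    by (simp_all add: signals_functionals)
  show "(x i \<longlongrightarrow> (\<Sum>k\<in>UNIV. \<omega> $ k * xbar k)) at_top"
    using main(3)[of i] by (simp add: target_def)
qed

end

theorem theorem1:
  fixes E :: "('n::finite \<times> 'n) set"
    and A :: "real^'n^'n"
    and b :: "'n \<Rightarrow> real"
    and l :: "'n \<Rightarrow> nat"
    and \<theta> :: "'n \<Rightarrow> nat \<Rightarrow> real"
    and \<phi> :: "'n \<Rightarrow> real \<Rightarrow> nat \<Rightarrow> real"
    and \<rho> \<nu> :: real
    and \<gamma> xbar :: "'n \<Rightarrow> real"
    and \<omega> :: "real^'n"
    and x0 :: "'n \<Rightarrow> real"
    and \<theta>hat0 :: "'n \<Rightarrow> nat \<Rightarrow> real"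
    and \<zeta>0 :: "'n \<Rightarrow> real"
  assumes "adjacency_matrix E A"
    and "strongly_connected E"
    and "\<And>i. b i \<noteq> 0"
    and "\<And>i k. k < l i \<Longrightarrow> smooth (\<lambda>y. \<phi> i y k)"
    and "\<rho> > 0" and "\<nu> > 0" and "\<And>i. \<gamma> i > 0"
    and "\<omega> v* laplacian A = 0"
    and "(\<Sum>k\<in>UNIV. \<omega> $ k) = 1"
  shows "(\<exists>x \<theta>hat \<zeta>. closed_loop E A b l \<theta> \<phi> \<rho> \<nu> \<gamma> xbar x \<theta>hat \<zeta> \<and>
             initial_condition l x0 \<theta>hat0 \<zeta>0 x \<theta>hat \<zeta>) \<and>
    (\<forall>x \<theta>hat \<zeta>. closed_loop E A b l \<theta> \<phi> \<rho> \<nu> \<gamma> xbar x \<theta>hat \<zeta> \<and>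
             initial_condition l x0 \<theta>hat0 \<zeta>0 x \<theta>hat \<zeta> \<longrightarrow>
       (\<forall>i. bounded_signal (x i) \<and>
            bounded_signal (z_signal E A \<rho> xbar x i) \<and>
            bounded_signal (consensus_integral E A x i) \<and>
            (\<forall>k<l i. bounded_signal (\<lambda>t. \<theta>hat i t k)) \<and>
            bounded_signal (\<zeta> i) \<and>
            bounded_signal (control E A l \<phi> \<rho> \<nu> xbar x \<theta>hat \<zeta> i)) \<and>
       (\<forall>i j. ((\<lambda>t. x i t - x j t) \<longlongrightarrow> 0) at_top) \<and>
       (\<forall>i. (x i \<longlongrightarrow> (\<Sum>k\<in>UNIV. \<omega> $ k * xbar k)) at_top))"
proof -
  interpret adaptive_consensus E A b l \<theta> \<phi> \<rho> \<nu> \<gamma> xbar \<omega>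
    by unfold_locales (use assms in auto)
  have "((\<lambda>t. x i t - x j t) \<longlongrightarrow> 0) at_top"
    if "closed_loop E A b l \<theta> \<phi> \<rho> \<nu> \<gamma> xbar x \<theta>hat \<zeta>"
      "initial_condition l x0 \<theta>hat0 \<zeta>0 x \<theta>hat \<zeta>" for x \<theta>hat \<zeta> i j
    using tendsto_diff[OF closed_loop_bounded_and_convergent(7)[OF that, of i]
        closed_loop_bounded_and_convergent(7)[OF that, of j]] by simp
  then show ?thesis
    by (intro conjI allI impI closed_loop_exists; elim conjE)
      (assumption | rule closed_loop_bounded_and_convergent)+
qed

end
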